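(* Let $p\in(0,\infty]$, $q\in(0,\infty]$, let $b$ be a slowly varying function, and assume $\mu(R)=\infty$. The space $L^{(p,q,b)}$ can be equipped with a Banach function norm equivalent to $\lVert\cdot\rVert_{(p,q,b)}$ if and only if $q\in[1,\infty]$ and one of the following conditions holds: (i) $p\in(1,\infty)$; (ii) $p=1$ and $\lVert t^{-1/q}b(t)\chi_{(1,\infty)}(t)\rVert_q<\infty$; (iii) $p=\infty$ and $\lVert t^{-1/q}b(t)\chi_{(0,1)}(t)\rVert_q<\infty$. Moreover, if these conditions are satisfied, then $\lVert\cdot\rVert_{(p,q,b)}$ is itself a Banach function norm.
   Context: $(R,\mu)$ is a $\sigma$-finite non-atomic measure space; $M=M(R,\mu)$ is the set of extended complex-valued $\mu$-measurable functions on $R$ (identified when equal $\mu$-a.e.), $M_+$ its non-negative elements. For $f\in M$, $f^*(t)=\inf\{s\ge 0:\mu(\{|f|>s\})\le t\}$ and $f^{**}(t)=\frac1t\int_0^t f^*(s)\,ds$. Convention: $1/\infty=0$. Two non-negative functions or functionals $g,h$ are equivalent, $g\approx h$, if there are constants $0<c\le C<\infty$ with $cg\le h\le Cg$. A measurable $b:(0,\infty)\to(0,\infty)$ is slowly varying if for every $\varepsilon>0$ there are a non-decreasing function $b_\varepsilon$ and a non-increasing function $b_{-\varepsilon}$ with $t^\varepsilon b(t)\approx b_\varepsilon(t)$ and $t^{-\varepsilon}b(t)\approx b_{-\varepsilon}(t)$ on $(0,\infty)$. For $f\in M$, $\lVert f\rVert_{(p,q,b)}=\lVert t^{1/p-1/q}b(t)f^{**}(t)\rVert_q$,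 where $\lVert\cdot\rVert_q$ is the Lebesgue $L^q$ (quasi)norm over $(0,\infty)$ in the variable $t$, and $L^{(p,q,b)}=\{f\in M:\lVert f\rVert_{(p,q,b)}<\infty\}$. A functional $\lVert\cdot\rVert:M\to[0,\infty]$ with $\lVert f\rVert=\lVert\,|f|\,\rVert$ is a Banach function norm if on $M_+$: (P1) it is positively homogeneous, subadditive, and $\lVert f\rVert=0\iff f=0$ a.e.; (P2) $f\le g$ a.e. implies $\lVert f\rVert\le\lVert g\rVert$; (P3) $f_n\uparrow f$ a.e. implies $\lVert f_n\rVert\uparrow\lVert f\rVert$; (P4) $\lVert\chi_E\rVert<\infty$ whenever $\mu(E)<\infty$; (P5) for each $E$ with $\mu(E)<\infty$ there is $C_E<\infty$ with $\int_E f\,d\mu\le C_E\lVert f\rVert$ for all $f\in M_+$. *)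

theory Defs
  imports "HOL-Probability.Essential_Supremum"
begin

section \<open>Extended complex-valued measurable functions\<close>

datatype ecomplex = Finite_Complex complex | Complex_Infinity

fun ecmod :: "ecomplex \<Rightarrow> ennreal" where
  "ecmod (Finite_Complex z) = ennreal (cmod z)"
| "ecmod Complex_Infinity = top"

definition ecomplex_of_ennreal :: "ennreal \<Rightarrow> ecomplex" where
  "ecomplex_of_ennreal x =
     (if x = top then Complex_Infinity else Finite_Complex (complex_of_real (enn2real x)))"

text \<open>The Borel sigma-algebra of the one-point compactification of the complex plane: its members
  are the sets whose finite part is a Borel subset of the plane, with or without the point at
  infinity.\<close>

definition ecomplex_borel :: "ecomplex measure" where
  "ecomplex_borel = sigma UNIV {A. Finite_Complex -` A \<in> sets borel}"

lemma sets_ecomplex_borel: "sets ecomplex_borel = {A. Finite_Complex -` A \<in> sets borel}"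
proof -
  have "sigma_algebra (UNIV :: ecomplex set) {A. Finite_Complex -` A \<in> sets borel}"
  proof (rule sigma_algebra_iff2[THEN iffD2], intro conjI ballI allI impI)
    fix s assume "s \<in> {A. Finite_Complex -` A \<in> sets borel}"
    then have "- (Finite_Complex -` s) \<in> sets borel"
      using borel_comp by auto
    then show "UNIV - s \<in> {A. Finite_Complex -` A \<in> sets borel}"
      by (simp add: vimage_Diff Compl_eq_Diff_UNIV)
  qed (auto simp: vimage_UN)
  then show ?thesis
    unfolding ecomplex_borel_def by (simp add: sigma_algebra.sigma_sets_eq)
qed

text \<open>Elements of \<open>M(R,\<mu>)\<close> are represented by functions rather than by classes modulo equality
  almost everywhere.  A Banach function norm as defined below automatically respects that
  identification, by monotonicity and its dependence on the modulus only.\<close>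

abbreviation mfuns :: "'a measure \<Rightarrow> ('a \<Rightarrow> ecomplex) set" where
  "mfuns M \<equiv> measurable M ecomplex_borel"

definition nonatomic :: "'a measure \<Rightarrow> bool" where
  "nonatomic M \<longleftrightarrow>
     (\<forall>A\<in>sets M. 0 < emeasure M A \<longrightarrow>
        (\<exists>B\<in>sets M. B \<subseteq> A \<and> 0 < emeasure M B \<and> emeasure M B < emeasure M A))"


section \<open>Equivalence and slowly varying functions\<close>

definition equivalent_on :: "'b set \<Rightarrow> ('b \<Rightarrow> ennreal) \<Rightarrow> ('b \<Rightarrow> ennreal) \<Rightarrow> bool" where
  "equivalent_on S g h \<longleftrightarrow>
     (\<exists>c C :: real. 0 < c \<and> c \<le> C \<and>
        (\<forall>x\<in>S. ennreal c * g x \<le> h x \<and> h x \<le> ennreal C * g x))"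

definition slowly_varying :: "(real \<Rightarrow> real) \<Rightarrow> bool" where
  "slowly_varying b \<longleftrightarrow>
     b \<in> borel_measurable (lebesgue_on {0<..}) \<and> (\<forall>t>0. 0 < b t) \<and>
     (\<forall>\<epsilon>>0.
        (\<exists>g :: real \<Rightarrow> real. (\<forall>t>0. 0 \<le> g t) \<and> mono_on {0<..} g \<and>
           equivalent_on {0<..} (\<lambda>t. ennreal (t powr \<epsilon> * b t)) (\<lambda>t. ennreal (g t))) \<and>
        (\<exists>g :: real \<Rightarrow> real. (\<forall>t>0. 0 \<le> g t) \<and> antimono_on {0<..} g \<and>
           equivalent_on {0<..} (\<lambda>t. ennreal (t powr (-\<epsilon>) * b t)) (\<lambda>t. ennreal (g t))))"


section \<open>Lorentz--Karamata functionals\<close>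

definition decr_rearr :: "'a measure \<Rightarrow> ('a \<Rightarrow> ecomplex) \<Rightarrow> real \<Rightarrow> ennreal" where
  "decr_rearr M f t =
     (INF s\<in>{s::real. 0 \<le> s \<and> emeasure M {x\<in>space M. ennreal s < ecmod (f x)} \<le> ennreal t}.
        ennreal s)"

definition max_rearr :: "'a measure \<Rightarrow> ('a \<Rightarrow> ecomplex) \<Rightarrow> real \<Rightarrow> ennreal" where
  "max_rearr M f t = ennreal (1 / t) * (\<integral>\<^sup>+s. decr_rearr M f s \<partial>lebesgue_on {0<..<t})"

text \<open>Used only for exponents \<open>a > 0\<close>.\<close>

definition ennpowr :: "ennreal \<Rightarrow> real \<Rightarrow> ennreal" where
  "ennpowr x a = (if x = top then top else ennreal (enn2real x powr a))"

definition Lq_norm :: "ennreal \<Rightarrow> (real \<Rightarrow> ennreal) \<Rightarrow> ennreal" where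
  "Lq_norm q g =
     (if q = top then esssup (lebesgue_on {0<..}) g
      else ennpowr (\<integral>\<^sup>+t. ennpowr (g t) (enn2real q) \<partial>lebesgue_on {0<..}) (1 / enn2real q))"

text \<open>\<open>1 / p\<close> as a real number, with \<open>1 / \<infinity> = 0\<close>; only used for \<open>p > 0\<close>.\<close>

definition recip :: "ennreal \<Rightarrow> real" where
  "recip p = enn2real (1 / p)"

definition lk_norm ::
    "'a measure \<Rightarrow> ennreal \<Rightarrow> ennreal \<Rightarrow> (real \<Rightarrow> real) \<Rightarrow> ('a \<Rightarrow> ecomplex) \<Rightarrow> ennreal" where
  "lk_norm M p q b f =
     Lq_norm q (\<lambda>t. ennreal (t powr (recip p - recip q) * b t) * max_rearr M f t)"

definition lk_space ::
    "'a measure \<Rightarrow> ennreal \<Rightarrow> ennreal \<Rightarrow> (real \<Rightarrow> real) \<Rightarrow> ('a \<Rightarrow> ecomplex) set" where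
  "lk_space M p q b = {f \<in> mfuns M. lk_norm M p q b f < \<infinity>}"


section \<open>Banach function norms\<close>

text \<open>\<open>M\<^sub>+\<close> is parametrised by the \<open>[0,\<infinity>]\<close>-valued measurable functions; \<open>on_nonneg N\<close> is the
  restriction of the functional \<open>N\<close> to \<open>M\<^sub>+\<close>.\<close>

definition on_nonneg :: "(('a \<Rightarrow> ecomplex) \<Rightarrow> ennreal) \<Rightarrow> ('a \<Rightarrow> ennreal) \<Rightarrow> ennreal" where
  "on_nonneg N u = N (\<lambda>x. ecomplex_of_ennreal (u x))"

definition banach_function_norm :: "'a measure \<Rightarrow> (('a \<Rightarrow> ecomplex) \<Rightarrow> ennreal) \<Rightarrow> bool" where
  "banach_function_norm M N \<longleftrightarrow>
     (\<forall>f\<in>mfuns M. N f = on_nonneg N (\<lambda>x. ecmod (f x))) \<and>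
     (\<forall>a::real. \<forall>u\<in>borel_measurable M. 0 \<le> a \<longrightarrow>
        on_nonneg N (\<lambda>x. ennreal a * u x) = ennreal a * on_nonneg N u) \<and>
     (\<forall>u\<in>borel_measurable M. \<forall>v\<in>borel_measurable M.
        on_nonneg N (\<lambda>x. u x + v x) \<le> on_nonneg N u + on_nonneg N v) \<and>
     (\<forall>u\<in>borel_measurable M. on_nonneg N u = 0 \<longleftrightarrow> (AE x in M. u x = 0)) \<and>
     (\<forall>u\<in>borel_measurable M. \<forall>v\<in>borel_measurable M.
        (AE x in M. u x \<le> v x) \<longrightarrow> on_nonneg N u \<le> on_nonneg N v) \<and>
     (\<forall>u v. (\<forall>n::nat. u n \<in> borel_measurable M) \<longrightarrow> v \<in> borel_measurable M \<longrightarrow>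
        (AE x in M. incseq (\<lambda>n. u n x) \<and> (\<lambda>n. u n x) \<longlonglongrightarrow> v x) \<longrightarrow>
        incseq (\<lambda>n. on_nonneg N (u n)) \<and>
        (\<lambda>n. on_nonneg N (u n)) \<longlonglongrightarrow> on_nonneg N v) \<and>
     (\<forall>E\<in>sets M. emeasure M E < \<infinity> \<longrightarrow> on_nonneg N (indicator E) < \<infinity>) \<and>
     (\<forall>E\<in>sets M. emeasure M E < \<infinity> \<longrightarrow>
        (\<exists>C::real. 0 \<le> C \<and>
           (\<forall>u\<in>borel_measurable M.
              (\<integral>\<^sup>+x\<in>E. u x \<partial>M) \<le> ennreal C * on_nonneg N u)))"

definition lk_admissible :: "ennreal \<Rightarrow> ennreal \<Rightarrow> (real \<Rightarrow> real) \<Rightarrow> bool" where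
  "lk_admissible p q b \<longleftrightarrow>
     1 \<le> q \<and>
     ((1 < p \<and> p < \<infinity>) \<or>
      (p = 1 \<and>
         Lq_norm q (\<lambda>t. ennreal (t powr (- recip q) * b t) * indicator {1<..} t) < \<infinity>) \<or>
      (p = \<infinity> \<and>
         Lq_norm q (\<lambda>t. ennreal (t powr (- recip q) * b t) * indicator {0<..<1} t) < \<infinity>))"

end

theory Submission
  imports Defs
begin

text \<open>
  By the layer-cake formula, \<open>t f\<^sup>*\<^sup>*(t)\<close> equals
  \<open>\<integral>\<^sub>0\<^sup>\<infinity> min(t, \<mu>(|f| > s)) ds\<close>, which in turn is the infimum over \<open>c \<ge> 0\<close> of
  \<open>\<integral> (|f| - c)\<^sup>+ d\<mu> + t c\<close>.  The first form gives monotone convergence and the local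
  embedding into \<open>L\<^sup>1\<close>, the second one gives subadditivity, and Minkowski's inequality
  transfers these properties to the functional when \<open>q \<ge> 1\<close>.

  Conversely, finiteness on indicators forces the conditions on \<open>p\<close>.  If \<open>q < 1\<close>, take indicators,
  normalised in the functional, of sets whose measure tends to infinity (for \<open>p < \<infinity>\<close>) or to zero
  (for \<open>p = \<infinity>\<close>).  Their mass in the defining integral leaves every member of a fixed exhaustion of the
  half-line, so that suitable sums of \<open>K\<close> of them have functional of order at least
  \<open>K\<^sup>1\<^sup>/\<^sup>q\<close>, while an equivalent norm would bound it by a multiple of \<open>K\<close>.
\<close>

subsection \<open>The integrated decreasing rearrangement\<close>

text \<open>The growth K^(1/q) is seen on the integrand of the q-th power of the functional, which
  is monotone in the function and whose integrals over complementary sets add. If nearly all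
  relevant mass of u lies in a member A of the exhaustion and v has at least half of its mass
  outside A, then u + v dominates u on A and v off A, so each normalised summand contributes at
  least 1/2. After K summands the q-th power exceeds K/2, whereas an equivalent norm with constants
  c and C bounds it by (C K / c)^q, which is smaller for large K when q < 1.

  Escape of mass needs a weight with infinite mass at one end of the half-line. An indicator of a
  set of measure m has the average min(1, m/t). For p < infinity the weight t^(1/p - 1/q) b(t) has
  infinite L^q norm at infinity, and large m exposes it. For p = infinity that norm may be finite,
  but t^(-1 - 1/q) b(t) always has infinite L^q norm at zero, and small m exposes it; non-atomicity
  supplies the small sets.\<close>

definition distr_fun :: "'a measure \<Rightarrow> ('a \<Rightarrow> ennreal) \<Rightarrow> real \<Rightarrow> ennreal" where
  "distr_fun M u s = emeasure M {x\<in>space M. ennreal s < u x}"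

text \<open>This is the integral of the decreasing rearrangement over \<open>(0, T)\<close>; see \<open>nn_integral_rearr\<close>.\<close>

definition rearr_integral :: "'a measure \<Rightarrow> ('a \<Rightarrow> ennreal) \<Rightarrow> ennreal \<Rightarrow> ennreal" where
  "rearr_integral M u T = (\<integral>\<^sup>+s\<in>{0..}. min T (distr_fun M u s) \<partial>lborel)"

lemma borel_measurable_antimono_ennreal:
  fixes f :: "real \<Rightarrow> ennreal"
  assumes "antimono f"
  shows "f \<in> borel_measurable borel"
proof (rule borel_measurableI_greater)
  fix y
  have "is_interval {x. y < f x}"
    unfolding is_interval_1 using assms by (auto simp: antimono_def intro: less_le_trans)
  then show "{x \<in> space borel. y < f x} \<in> sets borel"
    by (simp add: real_interval_borel_measurable)
qed

lemma distr_fun_antimono: "u \<in> borel_measurable M \<Longrightarrow> antimono (distr_fun M u)"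
  unfolding distr_fun_def
  by (intro antimonoI emeasure_mono) (auto intro: le_less_trans ennreal_leI)

lemma distr_fun_measurable [measurable]:
  "u \<in> borel_measurable M \<Longrightarrow> distr_fun M u \<in> borel_measurable borel"
  by (intro borel_measurable_antimono_ennreal distr_fun_antimono)

lemma distr_fun_mono_AE:
  assumes "v \<in> borel_measurable M" and "AE x in M. u x \<le> v x"
  shows "distr_fun M u s \<le> distr_fun M v s"
  unfolding distr_fun_def using assms(1)
  by (intro emeasure_mono_AE) (use assms(2) in \<open>auto elim!: eventually_mono\<close>, measurable)

text \<open>Writing an extended value as the length of the set of levels below it turns the
  layer-cake formula into an exchange of integrals, with the value infinity included.\<close>

lemma emeasure_lborel_less_ennreal: "emeasure lborel {s. 0 \<le> s \<and> ennreal s < y} = y"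
proof (cases "y = top")
  case True
  then have "{s. 0 \<le> s \<and> ennreal s < y} = {0::real..}" by auto
  moreover have "emeasure lborel {0::real..} = top"
  proof -
    have "of_nat n \<le> emeasure lborel {0::real..}" for n
      using emeasure_mono[of "{0..real n}" "{0::real..}" lborel]
      by (simp add: ennreal_of_nat_eq_real_of_nat)
    then have "(SUP n. of_nat n :: ennreal) \<le> emeasure lborel {0::real..}" by (rule SUP_least)
    then show ?thesis by (simp add: ennreal_SUP_of_nat_eq_top top_unique)
  qed
  ultimately show ?thesis using True by simp
next
  case False
  then have "{s. 0 \<le> s \<and> ennreal s < y} = {0..<enn2real y}"
    by (cases y) (auto simp: ennreal_less_iff)
  with False show ?thesis by (simp add: less_top)
qed

text \<open>Tonelli's theorem for the indicator of the region under the graph of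
  \<open>u\<close>.\<close>

lemma nn_integral_layer_cake:
  assumes "sigma_finite_measure M" and [measurable]: "u \<in> borel_measurable M"
  shows "(\<integral>\<^sup>+x. u x \<partial>M) = (\<integral>\<^sup>+s\<in>{0..}. distr_fun M u s \<partial>lborel)"
proof -
  interpret sigma_finite_measure M by fact
  interpret pair_sigma_finite M "lborel :: real measure" ..
  let ?k = "\<lambda>x s. indicator {s. 0 \<le> s \<and> ennreal s < u x} s :: ennreal"
  have "(\<integral>\<^sup>+x. u x \<partial>M) = (\<integral>\<^sup>+x. (\<integral>\<^sup>+s. ?k x s \<partial>lborel) \<partial>M)"
    by (simp add: emeasure_lborel_less_ennreal)
  also have "\<dots> = (\<integral>\<^sup>+s. (\<integral>\<^sup>+x. ?k x s \<partial>M) \<partial>lborel)"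
    by (rule Fubini'[symmetric]) measurable
  also have "\<dots> = (\<integral>\<^sup>+s\<in>{0..}. distr_fun M u s \<partial>lborel)"
  proof (rule nn_integral_cong)
    fix s :: real
    have "(\<integral>\<^sup>+x. ?k x s \<partial>M) = (\<integral>\<^sup>+x. indicator {0..} s * indicator {x\<in>space M. ennreal s < u x} x \<partial>M)"
      by (rule nn_integral_cong) (auto simp: indicator_def)
    then show "(\<integral>\<^sup>+x. ?k x s \<partial>M) = distr_fun M u s * indicator {0..} s"
      by (simp add: nn_integral_cmult distr_fun_def mult.commute)
  qed
  finally show ?thesis .
qed

text \<open>The formula of \<open>decr_rearr\<close>, read for functions that already take values in
  [0, infinity]; the two agree on moduli.\<close>

definition rearr :: "'a measure \<Rightarrow> ('a \<Rightarrow> ennreal) \<Rightarrow> real \<Rightarrow> ennreal" where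
  "rearr M u t = (INF s\<in>{s::real. 0 \<le> s \<and> distr_fun M u s \<le> ennreal t}. ennreal s)"

text \<open>The set where u > s is the increasing union of the sets where u > s + 1/(n+1), so
  continuity from below applies. For an antitone function the conclusion amounts to
  right-continuity.\<close>

lemma distr_fun_right_continuous:
  assumes [measurable]: "u \<in> borel_measurable M" and "y < distr_fun M u s" and "0 \<le> s"
  shows "\<exists>r>s. y < distr_fun M u r"
proof -
  let ?A = "\<lambda>n. {x\<in>space M. ennreal (s + 1 / real (Suc n)) < u x}"
  have "{x\<in>space M. ennreal s < u x} = (\<Union>n. ?A n)"
  proof (intro subset_antisym subsetI)
    fix x assume x: "x \<in> {x\<in>space M. ennreal s < u x}"
    then obtain z where z: "ennreal s < z" "z < u x" by (blast dest: dense)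
    then obtain r where "z = ennreal r" "0 \<le> r" by (cases z) auto
    with z have r: "ennreal s < ennreal r" "ennreal r < u x" "0 \<le> r" by auto
    then have "s < r" using \<open>0 \<le> s\<close> by (simp add: ennreal_less_iff)
    then obtain n where "1 / real (Suc n) < r - s"
      using reals_Archimedean[of "r - s"] by (auto simp: inverse_eq_divide)
    then have "ennreal (s + 1 / real (Suc n)) \<le> ennreal r" by (intro ennreal_leI) simp
    then have "ennreal (s + 1 / real (Suc n)) < u x" using r(2) by (rule le_less_trans)
    with x show "x \<in> (\<Union>n. ?A n)" by blast
  next
    fix x assume "x \<in> (\<Union>n. ?A n)"
    then obtain n where n: "x \<in> space M" "ennreal (s + 1 / real (Suc n)) < u x" by blast
    have "ennreal s \<le> ennreal (s + 1 / real (Suc n))" by (rule ennreal_leI) simp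
    then have "ennreal s < u x" using n(2) by (rule le_less_trans)
    with n show "x \<in> {x\<in>space M. ennreal s < u x}" by simp
  qed
  moreover have "(SUP n. emeasure M (?A n)) = emeasure M (\<Union>n. ?A n)"
  proof (rule SUP_emeasure_incseq)
    show "incseq ?A"
    proof (rule incseq_SucI, safe)
      fix n x assume "ennreal (s + 1 / real (Suc n)) < u x"
      moreover have "ennreal (s + 1 / real (Suc (Suc n))) \<le> ennreal (s + 1 / real (Suc n))"
        by (intro ennreal_leI) (simp add: field_simps)
      ultimately show "ennreal (s + 1 / real (Suc (Suc n))) < u x" by (rule le_less_trans[rotated])
    qed
  qed auto
  ultimately have "y < (SUP n. emeasure M (?A n))"
    using assms(2) by (simp add: distr_fun_def)
  then obtain n where "y < distr_fun M u (s + 1 / real (Suc n))"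
    by (auto simp: less_SUP_iff distr_fun_def)
  then show ?thesis by (intro exI[of _ "s + 1 / real (Suc n)"]) simp
qed

text \<open>The infimum defining the rearrangement need not be attained with room to spare.
  Right-continuity of the distribution function is what makes both inequalities strict, and hence
  makes the superlevel sets of the rearrangement explicit intervals.\<close>

lemma less_rearr_iff:
  assumes u [measurable]: "u \<in> borel_measurable M" and s: "0 \<le> s"
  shows "ennreal s < rearr M u t \<longleftrightarrow> ennreal t < distr_fun M u s"
proof
  assume "ennreal s < rearr M u t"
  then show "ennreal t < distr_fun M u s"
    using s by (auto simp: rearr_def not_le[symmetric] intro: INF_lower2)
next
  assume "ennreal t < distr_fun M u s"
  then obtain r where r: "s < r" "ennreal t < distr_fun M u r"
    using distr_fun_right_continuous[OF u _ s] by blast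
  have "r \<le> s'" if "distr_fun M u s' \<le> ennreal t" for s'
    using that r antimonoD[OF distr_fun_antimono[OF u], of s' r] by (cases "r \<le> s'") auto
  then have "ennreal r \<le> rearr M u t"
    unfolding rearr_def by (intro INF_greatest ennreal_leI) auto
  moreover have "ennreal s < ennreal r" using r s by (simp add: ennreal_less_iff)
  ultimately show "ennreal s < rearr M u t" by order
qed

lemma rearr_antimono: "antimono (rearr M u)"
  unfolding rearr_def
  by (intro antimonoI INF_superset_mono) (auto intro: order_trans ennreal_leI)

text \<open>Layer-cake formula for the rearrangement cut off to (0, T): its superlevel set at level
  s is an interval of length min(T, mu(u > s)).\<close>

lemma nn_integral_rearr:
  assumes [measurable]: "u \<in> borel_measurable M"
  shows "(\<integral>\<^sup>+s. rearr M u s \<partial>lebesgue_on {0<..<T}) = rearr_integral M u (ennreal T)"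
proof -
  have [measurable]: "rearr M u \<in> borel_measurable borel"
    by (intro borel_measurable_antimono_ennreal rearr_antimono)
  let ?v = "\<lambda>t. rearr M u t * indicator {0<..<T} t"
  have "(\<integral>\<^sup>+s. rearr M u s \<partial>lebesgue_on {0<..<T}) = (\<integral>\<^sup>+t. ?v t \<partial>lborel)"
    by (simp add: nn_integral_restrict_space nn_integral_completion)
  also have "\<dots> = (\<integral>\<^sup>+s\<in>{0..}. distr_fun lborel ?v s \<partial>lborel)"
    by (intro nn_integral_layer_cake sigma_finite_lborel) measurable
  also have "\<dots> = rearr_integral M u (ennreal T)"
    unfolding rearr_integral_def
  proof (intro nn_integral_cong)
    fix s :: real
    have "distr_fun lborel ?v s = min (ennreal T) (distr_fun M u s)" if "0 \<le> s"
    proof -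
      let ?y = "min (ennreal T) (distr_fun M u s)"
      \<comment> \<open>The cut-off lives on an open interval, hence the null set {0} is
        removed.\<close>
      have "{t. ennreal s < ?v t} = {t. 0 \<le> t \<and> ennreal t < ?y} - {0}"
        using that by (auto simp: indicator_def less_rearr_iff ennreal_less_iff)
      moreover have "emeasure lborel ({t. 0 \<le> t \<and> ennreal t < ?y} - {0}) = ?y"
        by (subst emeasure_Diff_null_set) (simp_all only: emeasure_lborel_less_ennreal, auto)
      ultimately show ?thesis by (simp add: distr_fun_def)
    qed
    then show "distr_fun lborel ?v s * indicator {0..} s = min (ennreal T) (distr_fun M u s) * indicator {0..} s"
      by (auto simp: indicator_def)
  qed
  finally show ?thesis .
qed

section \<open>From extended complex functions to functions with values in [0, infinity]\<close>

lemma ecmod_measurable [measurable]: "ecmod \<in> borel_measurable ecomplex_borel"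
proof (rule measurableI)
  fix A :: "ennreal set" assume A: "A \<in> sets borel"
  have "Finite_Complex -` (ecmod -` A) = (\<lambda>z. ennreal (cmod z)) -` A \<inter> space borel" by auto
  also have "\<dots> \<in> sets borel" by (rule measurable_sets[OF _ A]) measurable
  finally show "ecmod -` A \<inter> space ecomplex_borel \<in> sets ecomplex_borel"
    by (simp add: sets_ecomplex_borel ecomplex_borel_def)
qed simp

lemma ecomplex_of_ennreal_measurable [measurable]: "ecomplex_of_ennreal \<in> measurable borel ecomplex_borel"
proof (rule measurableI)
  fix A assume "A \<in> sets ecomplex_borel"
  then have [measurable]: "Finite_Complex -` A \<in> sets borel" by (simp add: sets_ecomplex_borel)
  have "ecomplex_of_ennreal -` A =
      {x. x = top \<and> Complex_Infinity \<in> A \<or> x \<noteq> top \<and> complex_of_real (enn2real x) \<in> Finite_Complex -` A}"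
    by (auto simp: ecomplex_of_ennreal_def split: if_splits)
  also have "\<dots> \<in> sets borel" by measurable
  finally show "ecomplex_of_ennreal -` A \<inter> space borel \<in> sets borel" by simp
qed (simp add: ecomplex_borel_def)

lemma ecmod_ecomplex_of_ennreal [simp]: "ecmod (ecomplex_of_ennreal x) = x"
  by (cases x) (auto simp: ecomplex_of_ennreal_def)

lemma max_rearr_eq:
  assumes [measurable]: "f \<in> mfuns M"
  shows "max_rearr M f t = ennreal (1 / t) * rearr_integral M (\<lambda>x. ecmod (f x)) (ennreal t)"
proof -
  have "decr_rearr M f = rearr M (\<lambda>x. ecmod (f x))"
    by (simp add: fun_eq_iff decr_rearr_def rearr_def distr_fun_def)
  then show ?thesis by (simp add: max_rearr_def nn_integral_rearr)
qed

section \<open>Monotonicity, scaling and monotone convergence of the integrated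
  rearrangement\<close>

lemma rearr_integral_mono_AE:
  assumes [measurable]: "v \<in> borel_measurable M" and "AE x in M. u x \<le> v x" and "S \<le> T"
  shows "rearr_integral M u S \<le> rearr_integral M v T"
  unfolding rearr_integral_def
  by (intro nn_integral_mono mult_right_mono min.mono assms distr_fun_mono_AE) auto

text \<open>Division-free form of the fact that the average over (0, T) decreases in T. It holds
  level by level, because min(T, d)/T decreases in T for each fixed d.\<close>

lemma rearr_integral_quotient_antimono:
  assumes [measurable]: "u \<in> borel_measurable M" and "S \<le> T"
  shows "S * rearr_integral M u T \<le> T * rearr_integral M u S"
proof -
  have "S * (min T (distr_fun M u s) * indicator {0..} s) \<le> T * (min S (distr_fun M u s) * indicator {0..} s)" for s
  proof (cases "S \<le> distr_fun M u s")
    case True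
    then have "S * min T (distr_fun M u s) \<le> T * min S (distr_fun M u s)"
      by (simp add: min_absorb1 mult.commute mult_left_mono)
    then show ?thesis by (auto simp: indicator_def)
  next
    case False
    then have "min S (distr_fun M u s) = distr_fun M u s" "min T (distr_fun M u s) = distr_fun M u s"
      using assms(2) by auto
    then show ?thesis using assms(2) by (auto intro!: mult_right_mono)
  qed
  then show ?thesis
    by (auto simp: rearr_integral_def nn_integral_cmult[symmetric] intro!: nn_integral_mono)
qed

text \<open>The substitution s -> a s in the level variable; it requires a > 0, so the factor zero
  is separate.\<close>

lemma rearr_integral_cmult:
  assumes [measurable]: "u \<in> borel_measurable M" and "0 \<le> a"
  shows "rearr_integral M (\<lambda>x. ennreal a * u x) T = ennreal a * rearr_integral M u T"
proof (cases "a = 0")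
  case True
  then show ?thesis by (simp add: rearr_integral_def distr_fun_def)
next
  case False
  with assms have a: "0 < a" by simp
  have "distr_fun M (\<lambda>x. ennreal a * u x) (a * s) = distr_fun M u s" if "0 \<le> s" for s
  proof -
    have "ennreal (a * s) < ennreal a * y \<longleftrightarrow> ennreal s < y" for y
    proof (cases y)
      case (real r)
      then show ?thesis using a that by (simp add: ennreal_mult[symmetric] ennreal_less_iff)
    qed (use a in \<open>simp add: ennreal_mult_top\<close>)
    then show ?thesis by (simp add: distr_fun_def)
  qed
  then have "min T (distr_fun M (\<lambda>x. ennreal a * u x) (a * s)) * indicator {0..} (a * s)
      = min T (distr_fun M u s) * indicator {0..} s" for s
    using a by (cases "0 \<le> s") (auto simp: indicator_def zero_le_mult_iff)
  then show ?thesis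
    unfolding rearr_integral_def using a
    by (subst nn_integral_real_affine[where c = a and t = 0]) auto
qed

lemma rearr_integral_indicator:
  assumes [measurable]: "E \<in> sets M"
  shows "rearr_integral M (indicator E) T = min T (emeasure M E)"
proof -
  have "distr_fun M (indicator E) s = emeasure M E * indicator {..<1} s" if "0 \<le> s" for s
  proof -
    have "{x \<in> space M. ennreal s < indicator E x} = (if s < 1 then E else {})"
      using sets.sets_into_space[OF assms] that
      by (auto simp: indicator_def ennreal_less_one_iff not_less split: if_splits)
    then show ?thesis by (simp add: distr_fun_def indicator_def)
  qed
  then have "min T (distr_fun M (indicator E) s) * indicator {0..} s = min T (emeasure M E) * indicator {0..<1} s" for s
    by (auto simp: indicator_def)
  then show ?thesis
    by (simp add: rearr_integral_def nn_integral_cmult)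
qed

text \<open>A vanishing integral controls only almost every level. Antitonicity upgrades this to
  every r > 0: a non-zero value of the distribution function at r would persist on [0, r], a set of
  positive length. The levels 1/(n+1) then exhaust the set where u > 0.\<close>

lemma rearr_integral_eq_0D:
  assumes [measurable]: "u \<in> borel_measurable M" and "rearr_integral M u T = 0" and "0 < T"
  shows "AE x in M. u x = 0"
proof -
  have "AE s in lborel. min T (distr_fun M u s) * indicator {0..} s = 0"
    using assms(2) unfolding rearr_integral_def by (subst (asm) nn_integral_0_iff_AE) auto
  then have ae: "AE s in lborel. 0 \<le> s \<longrightarrow> distr_fun M u s = 0"
  proof eventually_elim
    fix s assume s: "min T (distr_fun M u s) * indicator {0..} s = 0"
    have "distr_fun M u s = 0" if "0 \<le> s"
    proof (cases "T \<le> distr_fun M u s")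
      case True
      with s that \<open>0 < T\<close> show ?thesis by (simp add: min_absorb1)
    next
      case False
      with s that show ?thesis by (simp add: min_absorb2)
    qed
    then show "0 \<le> s \<longrightarrow> distr_fun M u s = 0" by simp
  qed
  have "distr_fun M u r = 0" if "0 < r" for r
  proof (rule ccontr)
    assume "distr_fun M u r \<noteq> 0"
    then have "distr_fun M u s \<noteq> 0" if "s \<le> r" for s
      using antimonoD[OF distr_fun_antimono[OF assms(1)] that] by auto
    with ae have "AE s in lborel. s \<notin> {0..r}" by (auto elim!: eventually_mono)
    then have "{0..r} \<in> null_sets lborel"
      by (intro AE_iff_null_sets[THEN iffD2]) auto
    with that show False by (simp add: null_sets_def)
  qed
  then have "AE x in M. \<not> ennreal (1 / real (Suc n)) < u x" for n
    by (subst AE_iff_measurable[OF _ refl]) (auto simp: distr_fun_def)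
  then have "AE x in M. \<forall>n. \<not> ennreal (1 / real (Suc n)) < u x" by (subst AE_all_countable) auto
  then show ?thesis
  proof eventually_elim
    fix x assume x: "\<forall>n. \<not> ennreal (1 / real (Suc n)) < u x"
    show "u x = 0"
    proof (rule ccontr)
      assume "u x \<noteq> 0"
      then obtain n where "ennreal (1 / real (Suc n)) < u x"
      proof (cases "u x")
        case (real r)
        with \<open>u x \<noteq> 0\<close> obtain n where "1 / real (Suc n) < r"
          using reals_Archimedean[of r] by (auto simp: inverse_eq_divide less_le)
        with real that show ?thesis by (auto simp: ennreal_less_iff)
      qed auto
      with x show False by blast
    qed
  qed
qed

text \<open>Monotone convergence is used twice, for the measures of superlevel sets and then for the
  integral over the levels; in between, min(T, .) commutes with suprema.\<close>

lemma rearr_integral_SUP: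
  assumes [measurable]: "\<And>n::nat. u n \<in> borel_measurable M" "v \<in> borel_measurable M"
    and conv: "AE x in M. incseq (\<lambda>n. u n x) \<and> (\<lambda>n. u n x) \<longlonglongrightarrow> v x"
  shows "rearr_integral M v T = (SUP n. rearr_integral M (u n) T)"
proof -
  have AE_le: "AE x in M. u n x \<le> u m x" if "n \<le> m" for n m
    using conv by eventually_elim (use that in \<open>auto dest: incseqD\<close>)
  have distr: "distr_fun M v s = (SUP n. distr_fun M (u n) s)" for s
  proof -
    let ?P = "\<lambda>x. incseq (\<lambda>n. u n x) \<and> (\<lambda>n. u n x) \<longlonglongrightarrow> v x"
    \<comment> \<open>The superlevel sets of the \<open>u n\<close> increase only up to null sets.
      Their finite unions have the same measures and are genuinely nested.\<close>
    let ?A = "\<lambda>n. {x\<in>space M. \<exists>k\<le>n. ennreal s < u k x}"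
    have eq: "distr_fun M (u n) s = emeasure M (?A n)" for n
      unfolding distr_fun_def
    proof (rule emeasure_eq_AE)
      show "AE x in M. (x \<in> {x \<in> space M. ennreal s < u n x}) = (x \<in> ?A n)"
        using conv by eventually_elim (auto intro: less_le_trans dest: incseqD)
    qed auto
    have "distr_fun M v s = emeasure M (\<Union>n. ?A n)"
      unfolding distr_fun_def
    proof (rule emeasure_eq_AE)
      show "AE x in M. (x \<in> {x \<in> space M. ennreal s < v x}) = (x \<in> (\<Union>n. ?A n))"
        using conv
      proof eventually_elim
        fix x assume "?P x"
        then have "v x = (SUP n. u n x)" using LIMSEQ_SUP LIMSEQ_unique by blast
        then show "(x \<in> {x \<in> space M. ennreal s < v x}) = (x \<in> (\<Union>n. ?A n))"
          by (auto simp: less_SUP_iff)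
      qed
    qed auto
    also have "\<dots> = (SUP n. emeasure M (?A n))"
      by (rule SUP_emeasure_incseq[symmetric]) (auto simp: incseq_def intro: order_trans)
    finally show ?thesis by (simp add: eq)
  qed
  have "rearr_integral M v T = (\<integral>\<^sup>+s. (SUP n. min T (distr_fun M (u n) s) * indicator {0..} s) \<partial>lborel)"
    unfolding rearr_integral_def
  proof (rule nn_integral_cong)
    fix s
    have "min T (SUP n. distr_fun M (u n) s) = (SUP n. min T (distr_fun M (u n) s))"
      using inf_SUP[of T "\<lambda>n. distr_fun M (u n) s" UNIV] by (simp add: inf_min)
    then show "min T (distr_fun M v s) * indicator {0..} s
        = (SUP n. min T (distr_fun M (u n) s) * indicator {0..} s)"
      by (cases "0 \<le> s") (simp_all add: distr)
  qed
  also have "\<dots> = (SUP n. rearr_integral M (u n) T)"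
    unfolding rearr_integral_def
  proof (rule nn_integral_monotone_convergence_SUP)
    show "incseq (\<lambda>n s. min T (distr_fun M (u n) s) * indicator {0..} s)"
      by (intro incseq_SucI le_funI mult_right_mono min.mono distr_fun_mono_AE AE_le) auto
  qed measurable
  finally show ?thesis .
qed

section \<open>The truncation formula and subadditivity\<close>

lemma nn_integral_minus_const_layer_cake:
  assumes "sigma_finite_measure M" and [measurable]: "u \<in> borel_measurable M" and "0 \<le> c"
  shows "(\<integral>\<^sup>+x. u x - ennreal c \<partial>M) = (\<integral>\<^sup>+s. distr_fun M u s * indicator {c..} s \<partial>lborel)"
proof -
  \<comment> \<open>Subtraction in \<open>ennreal\<close> is cut off at zero, so u - c is the
    positive part of the difference, and its distribution function is a translate.\<close>
  have shift: "distr_fun M (\<lambda>x. u x - ennreal c) s = distr_fun M u (c + s)" if "0 \<le> s" for s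
  proof -
    have "ennreal s < y - ennreal c \<longleftrightarrow> ennreal (c + s) < y" for y
      using that \<open>0 \<le> c\<close> by (simp add: less_diff_eq_ennreal add.commute)
    then show ?thesis by (simp add: distr_fun_def)
  qed
  have "(\<integral>\<^sup>+s. distr_fun M u s * indicator {c..} s \<partial>lborel)
      = (\<integral>\<^sup>+s. distr_fun M u (c + s) * indicator {c..} (c + s) \<partial>lborel)"
    by (subst nn_integral_real_affine[where c = 1 and t = c]) auto
  also have "\<dots> = (\<integral>\<^sup>+s\<in>{0..}. distr_fun M (\<lambda>x. u x - ennreal c) s \<partial>lborel)"
    by (intro nn_integral_cong) (auto simp: indicator_def shift)
  also have "\<dots> = (\<integral>\<^sup>+x. u x - ennreal c \<partial>M)"
    by (intro nn_integral_layer_cake[symmetric] assms) measurable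
  finally show ?thesis by simp
qed

text \<open>The minimum of T and the distribution function is bounded by T on levels below c and by
  the distribution function above c.\<close>

lemma rearr_integral_le_truncation:
  assumes "sigma_finite_measure M" and [measurable]: "u \<in> borel_measurable M" and c: "0 \<le> c"
  shows "rearr_integral M u T \<le> (\<integral>\<^sup>+x. u x - ennreal c \<partial>M) + T * ennreal c"
proof -
  have "rearr_integral M u T \<le> (\<integral>\<^sup>+s. T * indicator {0..<c} s + distr_fun M u s * indicator {c..} s \<partial>lborel)"
    unfolding rearr_integral_def by (intro nn_integral_mono) (auto simp: indicator_def)
  also have "\<dots> = T * ennreal c + (\<integral>\<^sup>+s. distr_fun M u s * indicator {c..} s \<partial>lborel)"
    using \<open>0 \<le> c\<close> by (simp add: nn_integral_add nn_integral_cmult)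
  also have "(\<integral>\<^sup>+s. distr_fun M u s * indicator {c..} s \<partial>lborel) = (\<integral>\<^sup>+x. u x - ennreal c \<partial>M)"
    using c by (intro nn_integral_minus_const_layer_cake[symmetric] assms)
  finally show ?thesis by (simp add: add.commute)
qed

text \<open>Equality holds when c is the level at which the distribution function falls from above T
  to at most T, that is, the value of the rearrangement at T. If there were no such level, the
  integrand would be the constant T > 0 on a half-line, against finiteness.\<close>

lemma rearr_integral_eq_truncation:
  assumes "sigma_finite_measure M" and [measurable]: "u \<in> borel_measurable M"
    and "0 < T" and fin: "rearr_integral M u T < top"
  shows "\<exists>c\<ge>0. (\<integral>\<^sup>+x. u x - ennreal c \<partial>M) + T * ennreal c = rearr_integral M u T"
proof -
  define S where "S = {s. 0 \<le> s \<and> distr_fun M u s \<le> T}"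
  have "S \<noteq> {}"
  proof
    assume "S = {}"
    have "rearr_integral M u T = (\<integral>\<^sup>+s. T * indicator {0::real..} s \<partial>lborel)"
      unfolding rearr_integral_def
    proof (intro nn_integral_cong)
      fix s
      have "T \<le> distr_fun M u s" if "0 \<le> s" using that \<open>S = {}\<close> by (force simp: S_def)
      then show "min T (distr_fun M u s) * indicator {0..} s = T * indicator {0..} s"
        by (cases "0 \<le> s") (auto simp: min_absorb1)
    qed
    also have "\<dots> = T * emeasure lborel {0::real..}" by (simp add: nn_integral_cmult)
    also have "emeasure lborel {0::real..} = top"
      using emeasure_lborel_less_ennreal[of top] by (simp add: atLeast_def)
    finally show False using fin \<open>0 < T\<close> by (cases "T = 0") (simp_all add: ennreal_mult_top)
  qed
  have bdd: "bdd_below S" by (auto simp: S_def)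
  define c where "c = Inf S"
  have c: "0 \<le> c" unfolding c_def using \<open>S \<noteq> {}\<close> by (intro cInf_greatest) (auto simp: S_def)
  have below: "T \<le> distr_fun M u s" if "0 \<le> s" "s < c" for s
    using that cInf_lower[OF _ bdd, of s] by (force simp: c_def S_def)
  have above: "distr_fun M u s \<le> T" if s: "c < s" for s
  proof -
    obtain r where "r \<in> S" "r < s" using cInf_lessD[of S s] s \<open>S \<noteq> {}\<close> by (auto simp: c_def)
    then show ?thesis
      using antimonoD[OF distr_fun_antimono[OF assms(2)], of r s] by (auto simp: S_def)
  qed
  have "rearr_integral M u T = (\<integral>\<^sup>+s. T * indicator {0..<c} s + distr_fun M u s * indicator {c..} s \<partial>lborel)"
    unfolding rearr_integral_def
  proof (rule nn_integral_cong_AE)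
    \<comment> \<open>The bounds \<open>below\<close> and \<open>above\<close> leave the single
      level c undecided; it is a null set.\<close>
    have "AE s in lborel. s \<noteq> c" by (rule AE_lborel_singleton)
    then show "AE s in lborel. min T (distr_fun M u s) * indicator {0..} s
        = T * indicator {0..<c} s + distr_fun M u s * indicator {c..} s"
      by eventually_elim (use c below above in \<open>auto simp: indicator_def min_absorb1 min_absorb2\<close>)
  qed
  also have "\<dots> = T * ennreal c + (\<integral>\<^sup>+s. distr_fun M u s * indicator {c..} s \<partial>lborel)"
    using \<open>0 \<le> c\<close> by (simp add: nn_integral_add nn_integral_cmult)
  also have "(\<integral>\<^sup>+s. distr_fun M u s * indicator {c..} s \<partial>lborel) = (\<integral>\<^sup>+x. u x - ennreal c \<partial>M)"
    using c by (intro nn_integral_minus_const_layer_cake[symmetric] assms)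
  finally show ?thesis using c by (auto simp: add.commute)
qed

text \<open>With optimal truncation levels c for u and d for v, the level c + d is a legitimate
  choice for u + v, and the positive part of u + v - (c + d) is at most the sum of those of u - c
  and v - d.\<close>

lemma rearr_integral_add:
  assumes sf: "sigma_finite_measure M" and [measurable]: "u \<in> borel_measurable M" "v \<in> borel_measurable M"
    and "0 < T"
  shows "rearr_integral M (\<lambda>x. u x + v x) T \<le> rearr_integral M u T + rearr_integral M v T"
proof (cases "rearr_integral M u T = top \<or> rearr_integral M v T = top")
  case False
  then obtain c d where c: "0 \<le> c" "(\<integral>\<^sup>+x. u x - ennreal c \<partial>M) + T * ennreal c = rearr_integral M u T"
    and d: "0 \<le> d" "(\<integral>\<^sup>+x. v x - ennreal d \<partial>M) + T * ennreal d = rearr_integral M v T"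
    using rearr_integral_eq_truncation[OF sf assms(2,4)] rearr_integral_eq_truncation[OF sf assms(3,4)]
    by (auto simp: less_top)
  have le: "y \<le> y - ennreal e + ennreal e" if "0 \<le> e" for y e
  proof (cases "ennreal e \<le> y")
    case True
    then show ?thesis by (simp add: diff_add_cancel_ennreal)
  qed (auto intro: add_increasing)
  have pt: "y + z - ennreal (c + d) \<le> (y - ennreal c) + (z - ennreal d)" for y z
  proof -
    have "y + z \<le> (y - ennreal c + ennreal c) + (z - ennreal d + ennreal d)"
      by (intro add_mono le c d)
    also have "\<dots> = ennreal (c + d) + ((y - ennreal c) + (z - ennreal d))"
      using c d by (simp add: algebra_simps)
    finally show ?thesis by (simp add: ennreal_minus_le_iff)
  qed
  have "rearr_integral M (\<lambda>x. u x + v x) T \<le> (\<integral>\<^sup>+x. u x + v x - ennreal (c + d) \<partial>M) + T * ennreal (c + d)"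
    using c d by (intro rearr_integral_le_truncation sf) auto
  also have "\<dots> \<le> (\<integral>\<^sup>+x. (u x - ennreal c) + (v x - ennreal d) \<partial>M) + T * ennreal (c + d)"
    by (intro add_right_mono nn_integral_mono pt)
  also have "\<dots> = rearr_integral M u T + rearr_integral M v T"
    using c(1) d(1) by (simp add: nn_integral_add c(2)[symmetric] d(2)[symmetric] algebra_simps)
  finally show ?thesis .
qed auto

text \<open>A case of the Hardy-Littlewood inequality: a superlevel set of u restricted to E lies in
  E and in the superlevel set of u, so its measure is at most the minimum of the two
  measures.\<close>

lemma set_nn_integral_le_rearr_integral:
  assumes sf: "sigma_finite_measure M" and [measurable]: "u \<in> borel_measurable M" "E \<in> sets M"
  shows "(\<integral>\<^sup>+x\<in>E. u x \<partial>M) \<le> rearr_integral M u (emeasure M E)"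
proof -
  have "(\<integral>\<^sup>+x\<in>E. u x \<partial>M) = (\<integral>\<^sup>+s\<in>{0..}. distr_fun M (\<lambda>x. u x * indicator E x) s \<partial>lborel)"
    by (intro nn_integral_layer_cake sf) measurable
  also have "\<dots> \<le> rearr_integral M u (emeasure M E)"
    unfolding rearr_integral_def
  proof (intro nn_integral_mono mult_right_mono min.boundedI)
    show "distr_fun M (\<lambda>x. u x * indicator E x) s \<le> emeasure M E" for s
      unfolding distr_fun_def by (intro emeasure_mono) (auto simp: indicator_def split: if_splits)
    show "distr_fun M (\<lambda>x. u x * indicator E x) s \<le> distr_fun M u s" for s
      by (intro distr_fun_mono_AE AE_I2) (auto simp: indicator_def)
  qed auto
  finally show ?thesis .
qed

subsection \<open>The Lebesgue quasinorm on the half-line\<close>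

lemma ennpowr_top [simp]: "ennpowr top a = top"
  by (simp add: ennpowr_def)

lemma ennpowr_ennreal: "0 \<le> x \<Longrightarrow> ennpowr (ennreal x) a = ennreal (x powr a)"
  by (simp add: ennpowr_def)

lemma ennpowr_0 [simp]: "ennpowr 0 a = 0"
  by (simp add: ennpowr_def)

lemma ennpowr_mono: "x \<le> y \<Longrightarrow> 0 < a \<Longrightarrow> ennpowr x a \<le> ennpowr y a"
  by (cases x; cases y) (auto simp: ennpowr_ennreal intro!: ennreal_leI powr_mono2 simp: top_unique)

lemma ennpowr_ennpowr: "0 < a \<Longrightarrow> 0 < b \<Longrightarrow> ennpowr (ennpowr x a) b = ennpowr x (a * b)"
  by (cases x) (auto simp: ennpowr_ennreal powr_powr)

lemma ennpowr_one [simp]: "ennpowr x 1 = x"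
  by (cases x) (auto simp: ennpowr_ennreal)

lemma ennpowr_inverse [simp]:
  assumes "0 < a"
  shows "ennpowr (ennpowr x a) (1 / a) = x" "ennpowr (ennpowr x (1 / a)) a = x"
  using assms by (simp_all add: ennpowr_ennpowr)

text \<open>The powers a and 1/a are mutually inverse and monotone, hence adjoint. Commutation with
  suprema and measurability both follow from this equivalence.\<close>

lemma ennpowr_le_iff: "0 < a \<Longrightarrow> ennpowr x a \<le> y \<longleftrightarrow> x \<le> ennpowr y (1 / a)"
  by (metis ennpowr_inverse ennpowr_mono zero_less_divide_1_iff)

lemma ennpowr_eq_0_iff: "0 < a \<Longrightarrow> ennpowr x a = 0 \<longleftrightarrow> x = 0"
  by (cases x) (auto simp: ennpowr_ennreal)

lemma ennpowr_mult: "0 < a \<Longrightarrow> ennpowr (x * y) a = ennpowr x a * ennpowr y a"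
  by (cases x; cases y)
     (auto simp: ennpowr_ennreal ennreal_mult[symmetric] powr_mult ennreal_mult_top ennreal_top_mult)

lemma ennpowr_SUP:
  assumes "0 < a"
  shows "ennpowr (SUP i\<in>I. f i) a = (SUP i\<in>I. ennpowr (f i) a)"
proof (rule antisym)
  show "ennpowr (SUP i\<in>I. f i) a \<le> (SUP i\<in>I. ennpowr (f i) a)"
    unfolding ennpowr_le_iff[OF assms]
  proof (rule SUP_least)
    fix i assume "i \<in> I"
    then have "ennpowr (f i) a \<le> (SUP i\<in>I. ennpowr (f i) a)" by (rule SUP_upper)
    then show "f i \<le> ennpowr (SUP i\<in>I. ennpowr (f i) a) (1 / a)" by (simp only: ennpowr_le_iff[OF assms])
  qed
qed (auto intro!: SUP_least ennpowr_mono SUP_upper assms)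

lemma ennpowr_measurable [measurable (raw)]:
  assumes [measurable]: "f \<in> borel_measurable N" and "0 < a"
  shows "(\<lambda>x. ennpowr (f x) a) \<in> borel_measurable N"
  by (rule borel_measurableI_le) (simp add: ennpowr_le_iff assms(2))

lemma ennpowr_less_top_iff: "ennpowr x a < top \<longleftrightarrow> x < top"
  by (cases x) (auto simp: ennpowr_ennreal)

text \<open>For positive arguments this is convexity of the power; when an argument is zero it
  reduces to l^r <= l for 0 < l < 1.\<close>

lemma powr_convex_nonneg:
  fixes x y l r :: real
  assumes "1 \<le> r" "0 \<le> x" "0 \<le> y" "0 < l" "l < 1"
  shows "(l * x + (1 - l) * y) powr r \<le> l * x powr r + (1 - l) * y powr r"
proof -
  have le: "l' * z powr r \<ge> (l' * z) powr r" if "0 \<le> z" "0 < l'" "l' < 1" for l' z :: real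
  proof -
    have "l' powr r \<le> l' powr 1" using that \<open>1 \<le> r\<close> by (intro powr_mono') auto
    then show ?thesis using that by (simp add: powr_mult mult_right_mono)
  qed
  consider "x = 0" | "y = 0" | "0 < x" "0 < y" using assms by fastforce
  then show ?thesis
  proof cases
    case 3
    show ?thesis
      using convex_onD[OF powr_convex[OF \<open>1 \<le> r\<close>], of "1 - l" x y] 3 assms by simp
  qed (use le[of y "1 - l"] le[of x l] assms in auto)
qed

lemma ennpowr_convex:
  assumes r: "1 \<le> r" and l: "0 < l" "l < 1"
  shows "ennpowr (ennreal l * x + ennreal (1 - l) * y) r \<le> ennreal l * ennpowr x r + ennreal (1 - l) * ennpowr y r"
proof (cases "x = top \<or> y = top")
  case True
  then show ?thesis using l by (auto simp: ennreal_mult_top)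
next
  case False
  then obtain s t where "x = ennreal s" "y = ennreal t" "0 \<le> s" "0 \<le> t"
    by (metis ennreal_cases)
  then show ?thesis
    using powr_convex_nonneg[OF r, of s t l] l r
    by (simp add: ennpowr_ennreal ennreal_mult[symmetric] ennreal_plus[symmetric] ennreal_leI del: ennreal_plus)
qed

section \<open>Norm properties of the Lebesgue functional\<close>

lemma Lq_norm_mono:
  assumes "f \<in> borel_measurable (lebesgue_on {0<..})" "0 < q"
    and "AE t in lebesgue_on {0<..}. f t \<le> g t"
  shows "Lq_norm q f \<le> Lq_norm q g"
proof (cases "q = top")
  case True
  then show ?thesis using assms by (simp add: Lq_norm_def esssup_AE_mono)
next
  case False
  then have "0 < enn2real q" using assms(2) by (simp add: enn2real_positive_iff less_top)
  then show ?thesis using assms(3) False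
    by (auto simp: Lq_norm_def intro!: ennpowr_mono nn_integral_mono_AE elim!: eventually_mono)
qed

lemma Lq_norm_eq_0_iff:
  assumes [measurable]: "f \<in> borel_measurable (lebesgue_on {0<..})" and "0 < q"
  shows "Lq_norm q f = 0 \<longleftrightarrow> (AE t in lebesgue_on {0<..}. f t = 0)"
proof (cases "q = top")
  case True
  have "esssup (lebesgue_on {0<..}) f = 0 \<longleftrightarrow> (AE t in lebesgue_on {0<..}. f t \<le> 0)"
  proof
    assume "esssup (lebesgue_on {0<..}) f = 0"
    then show "AE t in lebesgue_on {0<..}. f t \<le> 0"
      using esssup_AE[of f "lebesgue_on {0<..}"] by simp
  next
    assume "AE t in lebesgue_on {0<..}. f t \<le> 0"
    then have "esssup (lebesgue_on {0<..}) f \<le> 0" by (intro esssup_I) auto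
    then show "esssup (lebesgue_on {0<..}) f = 0" by simp
  qed
  then show ?thesis using True by (simp add: Lq_norm_def)
next
  case False
  then have q: "0 < enn2real q" using assms(2) by (simp add: enn2real_positive_iff less_top)
  then show ?thesis using False
    by (simp add: Lq_norm_def ennpowr_eq_0_iff nn_integral_0_iff_AE)
qed

text \<open>The factor c may be infinite, since it will be the value of an average. For the
  essential supremum the lower bound comes from multiplying by 1/c if c is finite and positive; if c
  is infinite and the supremum of c f is finite, then f vanishes almost everywhere.\<close>

lemma Lq_norm_cmult:
  assumes [measurable]: "f \<in> borel_measurable (lebesgue_on {0<..})" and "0 < q"
  shows "Lq_norm q (\<lambda>t. c * f t) = c * Lq_norm q f"
proof (cases "q = top")
  case True
  let ?L = "lebesgue_on {0::real<..}"
  have "c * esssup ?L f \<le> esssup ?L (\<lambda>t. c * f t)"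
  proof -
    have ae: "AE t in ?L. c * f t \<le> esssup ?L (\<lambda>t. c * f t)" (is "AE t in ?L. _ \<le> ?z")
      by (rule esssup_AE)
    consider "c = 0" | "?z = top" | "c = top" "?z \<noteq> top" | r where "c = ennreal r" "0 < r"
      by (cases c) (auto simp: less_le)
    then show ?thesis
    proof cases
      case 3
      with ae have "AE t in ?L. f t \<le> 0"
        by (auto elim!: eventually_mono simp: ennreal_top_mult top_unique split: if_splits)
      then have "esssup ?L f \<le> 0" by (intro esssup_I) auto
      then show ?thesis by simp
    next
      case 4
      then have one: "ennreal (1 / r) * (c * y) = y" "c * (ennreal (1 / r) * y) = y" for y
        by (simp_all add: mult.assoc[symmetric] ennreal_mult[symmetric])
      from ae have "AE t in ?L. f t \<le> ennreal (1 / r) * ?z"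
        by eventually_elim (metis mult_left_mono one(1) zero_le)
      then have "esssup ?L f \<le> ennreal (1 / r) * ?z" by (intro esssup_I) auto
      then have "c * esssup ?L f \<le> c * (ennreal (1 / r) * ?z)" by (rule mult_left_mono) simp
      then show ?thesis by (simp only: one)
    qed auto
  qed
  moreover have "esssup ?L (\<lambda>t. c * f t) \<le> c * esssup ?L f"
    using esssup_AE[of f ?L] by (intro esssup_I) (auto elim!: eventually_mono intro: mult_left_mono)
  ultimately show ?thesis using True by (simp add: Lq_norm_def antisym)
next
  case False
  then have q: "0 < enn2real q" using assms(2) by (simp add: enn2real_positive_iff less_top)
  then show ?thesis using False
    by (simp add: Lq_norm_def ennpowr_mult nn_integral_cmult)
qed

text \<open>For finite q and norms in (0, infinity), Minkowski's inequality follows from convexity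
  of the power: after f and g are divided by their norms a and b, the sum f + g becomes a + b times
  a convex combination of functions of norm one, so no conjugate exponent is involved.\<close>

lemma Lq_norm_triangle:
  assumes [measurable]: "f \<in> borel_measurable (lebesgue_on {0<..})" "g \<in> borel_measurable (lebesgue_on {0<..})"
    and q: "1 \<le> q"
  shows "Lq_norm q (\<lambda>t. f t + g t) \<le> Lq_norm q f + Lq_norm q g"
proof (cases "q = top")
  case True
  have "AE t in lebesgue_on {0<..}. f t + g t \<le> esssup (lebesgue_on {0<..}) f + esssup (lebesgue_on {0<..}) g"
    using esssup_AE[of f] esssup_AE[of g] by eventually_elim (rule add_mono)
  then show ?thesis using True by (auto simp: Lq_norm_def intro!: esssup_I)
next
  case False
  define r where "r = enn2real q"
  have r: "1 \<le> r" using q False unfolding r_def by (cases q) auto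
  let ?N = "Lq_norm q" let ?L = "lebesgue_on {0::real<..}"
  have N: "ennpowr (?N h) r = (\<integral>\<^sup>+t. ennpowr (h t) r \<partial>?L)" for h
    using False r by (simp add: Lq_norm_def r_def)
  have q0: "0 < q" using q by (rule less_le_trans[rotated]) simp
  consider "?N f = top \<or> ?N g = top" | "?N f = 0" | "?N g = 0"
    | a b where "0 < a" "0 < b" "?N f = ennreal a" "?N g = ennreal b"
    by (cases "?N f"; cases "?N g") (auto simp: less_le)
  then show ?thesis
  proof cases
    case 2
    then have "AE t in ?L. f t + g t \<le> g t" by (auto simp: Lq_norm_eq_0_iff q0 elim!: eventually_mono)
    then show ?thesis using q0 2 by (auto intro: Lq_norm_mono)
  next
    case 3
    then have "AE t in ?L. f t + g t \<le> f t" by (auto simp: Lq_norm_eq_0_iff q0 elim!: eventually_mono)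
    then show ?thesis using q0 3 by (auto intro: Lq_norm_mono)
  next
    case 4
    \<comment> \<open>This weight makes (a + b) l = a and (a + b) (1 - l) = b.\<close>
    define l where "l = a / (a + b)"
    have l: "0 < l" "l < 1" "1 - l = b / (a + b)" using 4 by (auto simp: l_def field_simps)
    have pt: "f t + g t = ennreal (a + b) * (ennreal l * (ennreal (1 / a) * f t) + ennreal (1 - l) * (ennreal (1 / b) * g t))" for t
      using 4 l(1,2) unfolding l(3) unfolding l_def
      by (simp add: distrib_left mult.assoc[symmetric] ennreal_mult[symmetric] del: ennreal_plus)
    have one: "(\<integral>\<^sup>+t. ennpowr (ennreal (1 / c) * h t) r \<partial>?L) = 1"
      if "?N h = ennreal c" "0 < c" "h \<in> borel_measurable ?L" for h c
    proof -
      have "?N (\<lambda>t. ennreal (1 / c) * h t) = 1"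
        using that q0 by (simp add: Lq_norm_cmult ennreal_mult[symmetric])
      then show ?thesis using N[of "\<lambda>t. ennreal (1 / c) * h t"] ennpowr_ennreal[of 1 r] by simp
    qed
    have "ennpowr (?N (\<lambda>t. f t + g t)) r
        \<le> (\<integral>\<^sup>+t. ennpowr (ennreal (a + b)) r * (ennreal l * ennpowr (ennreal (1 / a) * f t) r
              + ennreal (1 - l) * ennpowr (ennreal (1 / b) * g t) r) \<partial>?L)"
      unfolding N pt
    proof (intro nn_integral_mono)
      fix t
      show "ennpowr (ennreal (a + b) * (ennreal l * (ennreal (1 / a) * f t) + ennreal (1 - l) * (ennreal (1 / b) * g t))) r
          \<le> ennpowr (ennreal (a + b)) r * (ennreal l * ennpowr (ennreal (1 / a) * f t) r
              + ennreal (1 - l) * ennpowr (ennreal (1 / b) * g t) r)"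
        using r l(1,2) by (subst ennpowr_mult) (auto intro!: mult_left_mono ennpowr_convex simp del: ennreal_plus)
    qed
    also have "\<dots> = ennpowr (ennreal (a + b)) r"
      using r l(1,2) 4 by (simp add: nn_integral_cmult nn_integral_add one ennreal_plus[symmetric] del: ennreal_plus)
    finally show ?thesis
      using r 4 by (simp add: ennpowr_le_iff)
  qed auto
qed

lemma Lq_norm_SUP:
  assumes [measurable]: "\<And>n::nat. f n \<in> borel_measurable (lebesgue_on {0<..})"
    and inc: "incseq f" and "0 < q"
  shows "Lq_norm q (\<lambda>t. SUP n. f n t) = (SUP n. Lq_norm q (f n))"
proof (cases "q = top")
  case True
  have "AE t in lebesgue_on {0<..}. \<forall>n. f n t \<le> esssup (lebesgue_on {0<..}) (f n)"
    by (subst AE_all_countable) (simp add: esssup_AE)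
  then have "AE t in lebesgue_on {0<..}. (SUP n. f n t) \<le> (SUP n. esssup (lebesgue_on {0<..}) (f n))"
    by eventually_elim (auto intro: SUP_mono)
  then have "esssup (lebesgue_on {0<..}) (\<lambda>t. SUP n. f n t) \<le> (SUP n. esssup (lebesgue_on {0<..}) (f n))"
    by (intro esssup_I) auto
  moreover have "(SUP n. esssup (lebesgue_on {0<..}) (f n)) \<le> esssup (lebesgue_on {0<..}) (\<lambda>t. SUP n. f n t)"
    by (intro SUP_least esssup_mono SUP_upper) auto
  ultimately show ?thesis using True by (simp add: Lq_norm_def antisym)
next
  case False
  then have q: "0 < enn2real q" using assms(3) by (simp add: enn2real_positive_iff less_top)
  have "incseq (\<lambda>n t. ennpowr (f n t) (enn2real q))"
    using inc q by (auto simp: incseq_def le_fun_def intro!: ennpowr_mono)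
  then show ?thesis using False q
    by (simp add: Lq_norm_def ennpowr_SUP nn_integral_monotone_convergence_SUP)
qed

subsection \<open>Slowly varying functions and powers\<close>

text \<open>Passing through the monotone equivalents g and h costs one ratio of equivalence
  constants each; K is the larger of the two. The auxiliary functions then disappear from all later
  estimates.\<close>

lemma slowly_varying_mono_bounds:
  assumes "slowly_varying b" and "0 < \<epsilon>"
  shows "\<exists>K>0. \<forall>s t. 0 < s \<longrightarrow> s \<le> t \<longrightarrow>
    s powr \<epsilon> * b s \<le> K * (t powr \<epsilon> * b t) \<and> t powr (-\<epsilon>) * b t \<le> K * (s powr (-\<epsilon>) * b s)"
proof -
  have real_bounds: "\<exists>c C. 0 < c \<and> 0 < C \<and> (\<forall>t>0. c * F t \<le> g t \<and> g t \<le> C * F t)"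
    if pos: "\<forall>t>0. 0 \<le> g t" "\<forall>t>0. 0 \<le> F t" and equiv: "equivalent_on {0<..} (\<lambda>t. ennreal (F t)) (\<lambda>t. ennreal (g t))"
    for F g :: "real \<Rightarrow> real"
  proof -
    obtain c C where cC: "0 < c" "c \<le> C"
      and *: "\<And>t. 0 < t \<Longrightarrow> ennreal c * ennreal (F t) \<le> ennreal (g t) \<and> ennreal (g t) \<le> ennreal C * ennreal (F t)"
      using equiv by (auto simp: equivalent_on_def)
    have "c * F t \<le> g t \<and> g t \<le> C * F t" if "0 < t" for t
      using *[OF that] that pos cC
      by (simp add: ennreal_mult[symmetric] ennreal_le_iff)
    with cC show ?thesis by (intro exI[of _ c] exI[of _ C]) auto
  qed
  have b: "0 < b t" if "0 < t" for t using assms(1) that by (simp add: slowly_varying_def)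
  obtain g where g: "\<forall>t>0. 0 \<le> g t" "mono_on {0<..} g"
      "equivalent_on {0<..} (\<lambda>t. ennreal (t powr \<epsilon> * b t)) (\<lambda>t. ennreal (g t))"
    using assms by (auto simp: slowly_varying_def)
  obtain h where h: "\<forall>t>0. 0 \<le> h t" "antimono_on {0<..} h"
      "equivalent_on {0<..} (\<lambda>t. ennreal (t powr (-\<epsilon>) * b t)) (\<lambda>t. ennreal (h t))"
    using assms by (auto simp: slowly_varying_def)
  obtain c C where c: "0 < c" "0 < C" "\<And>t. 0 < t \<Longrightarrow> c * (t powr \<epsilon> * b t) \<le> g t \<and> g t \<le> C * (t powr \<epsilon> * b t)"
    using real_bounds[OF g(1) _ g(3)] b by (auto simp: less_imp_le)
  obtain d D where d: "0 < d" "0 < D" "\<And>t. 0 < t \<Longrightarrow> d * (t powr (-\<epsilon>) * b t) \<le> h t \<and> h t \<le> D * (t powr (-\<epsilon>) * b t)"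
    using real_bounds[OF h(1) _ h(3)] b by (auto simp: less_imp_le)
  define K where "K = max (C / c) (D / d)"
  have "s powr \<epsilon> * b s \<le> K * (t powr \<epsilon> * b t) \<and> t powr (-\<epsilon>) * b t \<le> K * (s powr (-\<epsilon>) * b s)"
    if "0 < s" "s \<le> t" for s t
  proof
    have "c * (s powr \<epsilon> * b s) \<le> g s" using c(3) that by auto
    also have "g s \<le> g t" using g(2) that by (auto simp: mono_on_def)
    also have "g t \<le> C * (t powr \<epsilon> * b t)" using c(3)[of t] that by auto
    finally have "s powr \<epsilon> * b s \<le> C / c * (t powr \<epsilon> * b t)" using c by (simp add: field_simps)
    also have "\<dots> \<le> K * (t powr \<epsilon> * b t)" using b[of t] that by (intro mult_right_mono) (auto simp: K_def)
    finally show "s powr \<epsilon> * b s \<le> K * (t powr \<epsilon> * b t)" .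
    have "d * (t powr (-\<epsilon>) * b t) \<le> h t" using d(3)[of t] that by auto
    also have "h t \<le> h s" using h(2) that by (auto simp: monotone_on_def)
    also have "h s \<le> D * (s powr (-\<epsilon>) * b s)" using d(3)[of s] that by auto
    finally have "t powr (-\<epsilon>) * b t \<le> D / d * (s powr (-\<epsilon>) * b s)" using d by (simp add: field_simps)
    also have "\<dots> \<le> K * (s powr (-\<epsilon>) * b s)" using b[of s] that by (intro mult_right_mono) (auto simp: K_def)
    finally show "t powr (-\<epsilon>) * b t \<le> K * (s powr (-\<epsilon>) * b s)" .
  qed
  moreover have "0 < K" using c d by (auto simp: K_def less_max_iff_disj)
  ultimately show ?thesis by blast
qed

text \<open>Take one of the two points in the quasi-monotonicity estimates to be 1. This confines b
  between constant multiples of powers with arbitrarily small exponents at both ends.\<close>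

lemma slowly_varying_bounds:
  assumes sv: "slowly_varying b" and "0 < \<epsilon>"
  shows "\<exists>K>0. \<forall>t>0. (t \<le> 1 \<longrightarrow> b t \<le> K * t powr (-\<epsilon>) \<and> t powr \<epsilon> \<le> K * b t) \<and>
    (1 \<le> t \<longrightarrow> b t \<le> K * t powr \<epsilon> \<and> t powr (-\<epsilon>) \<le> K * b t)"
proof -
  obtain K where K: "0 < K" "\<And>s t. 0 < s \<Longrightarrow> s \<le> t \<Longrightarrow>
    s powr \<epsilon> * b s \<le> K * (t powr \<epsilon> * b t) \<and> t powr (-\<epsilon>) * b t \<le> K * (s powr (-\<epsilon>) * b s)"
    using slowly_varying_mono_bounds[OF assms] by auto
  have b: "0 < b t" if "0 < t" for t using sv that by (simp add: slowly_varying_def)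
  \<comment> \<open>\<open>K * b 1\<close> serves the upper bounds for b and \<open>K / b 1\<close>
    the lower ones.\<close>
  define L where "L = max (K * b 1) (K / b 1)"
  have L: "0 < L" using K b[of 1] by (auto simp: L_def less_max_iff_disj)
  have "K * b 1 \<le> L" "K / b 1 \<le> L" by (auto simp: L_def)
  have upper: "b t \<le> L * x" if "b t * y \<le> K * b 1" "x * y = 1" "0 < y" for x y t
  proof -
    have "b t * y \<le> L * x * y" using that \<open>K * b 1 \<le> L\<close> by (simp add: mult.assoc)
    then show ?thesis using \<open>0 < y\<close> by simp
  qed
  have lower: "x \<le> L * b t" if "b 1 \<le> K * (y * b t)" "x * y = 1" "0 < x" "0 < t" for x y t
  proof -
    have "x * b 1 \<le> x * (K * (y * b t))" using that by (intro mult_left_mono) auto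
    also have "\<dots> = K * b t * (x * y)" by (simp add: algebra_simps)
    also have "\<dots> = K * b t" using that by simp
    finally have "x \<le> K / b 1 * b t" using b[of 1] by (simp add: field_simps)
    also have "\<dots> \<le> L * b t" using b[of t] that by (intro mult_right_mono) (auto simp: L_def)
    finally show ?thesis .
  qed
  have pw: "t powr \<epsilon> * t powr (-\<epsilon>) = 1" "t powr (-\<epsilon>) * t powr \<epsilon> = 1" if "0 < t" for t :: real
    using that by (simp_all add: powr_add[symmetric])
  show ?thesis
  proof (intro exI[of _ L] conjI allI impI L)
    fix t :: real assume t: "0 < t" "t \<le> 1"
    show "b t \<le> L * t powr (-\<epsilon>)"
      using K(2)[of t 1] t by (intro upper[OF _ pw(2)]) (auto simp: mult.commute)
    show "t powr \<epsilon> \<le> L * b t"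
      using K(2)[of t 1] t by (intro lower[OF _ pw(1)]) auto
  next
    fix t :: real assume t: "0 < t" "1 \<le> t"
    show "b t \<le> L * t powr \<epsilon>"
      using K(2)[of 1 t] t by (intro upper[OF _ pw(1)]) (auto simp: mult.commute)
    show "t powr (-\<epsilon>) \<le> L * b t"
      using K(2)[of 1 t] t by (intro lower[OF _ pw(2)]) auto
  qed
qed

section \<open>Integrals of powers near zero and near infinity\<close>

lemma nn_integral_Ioi: "(\<integral>\<^sup>+t. f t \<partial>lebesgue_on {0<..}) = (\<integral>\<^sup>+t\<in>{0<..}. f t \<partial>(lborel :: real measure))"
  by (simp add: nn_integral_restrict_space nn_integral_completion)

lemma nn_integral_powr_near_0:
  assumes "-1 < a"
  shows "(\<integral>\<^sup>+t\<in>{0<..<1}. ennreal (t powr a) \<partial>lebesgue_on {0<..}) < top"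
proof -
  have "(\<integral>\<^sup>+t\<in>{0<..<1}. ennreal (t powr a) \<partial>lebesgue_on {0<..})
      \<le> (\<integral>\<^sup>+t\<in>{0..1}. ennreal (t powr a) \<partial>lborel)"
    unfolding nn_integral_Ioi by (intro nn_integral_mono) (auto simp: indicator_def)
  also have "\<dots> = ennreal (1 powr (a + 1) / (a + 1))"
    using assms by (intro nn_integral_has_integral_lebesgue' has_integral_powr_from_0) auto
  finally show ?thesis by (rule le_less_trans) simp
qed

lemma nn_integral_powr_near_inf:
  assumes "a < -1"
  shows "(\<integral>\<^sup>+t\<in>{1<..}. ennreal (t powr a) \<partial>lebesgue_on {0<..}) < top"
proof -
  have "(\<integral>\<^sup>+t\<in>{1<..}. ennreal (t powr a) \<partial>lebesgue_on {0<..})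
      \<le> (\<integral>\<^sup>+t\<in>{1..}. ennreal (t powr a) \<partial>lborel)"
    unfolding nn_integral_Ioi by (intro nn_integral_mono) (auto simp: indicator_def)
  also have "\<dots> = ennreal (- (1 powr (a + 1)) / (a + 1))"
    using assms by (intro nn_integral_has_integral_lebesgue' has_integral_powr_to_inf) auto
  finally show ?thesis by (rule le_less_trans) simp
qed

lemma nn_integral_inverse_Icc:
  fixes x y :: real
  assumes "0 < x" "x \<le> y"
  shows "(\<integral>\<^sup>+t\<in>{x..y}. ennreal (t powr -1) \<partial>lborel) = ennreal (ln y - ln x)"
proof (rule nn_integral_has_integral_lebesgue')
  show "((\<lambda>t. t powr -1) has_integral ln y - ln x) {x..y}"
    using assms by (intro fundamental_theorem_of_calculus)
      (auto intro!: derivative_eq_intros simp: has_real_derivative_iff_has_vector_derivative[symmetric] powr_minus field_simps)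
qed auto

lemma ennreal_eq_topI:
  assumes "\<And>r. 0 \<le> r \<Longrightarrow> ennreal r \<le> x"
  shows "x = top"
proof (cases x)
  case (real r)
  then show ?thesis using assms[of "r + 1"] by simp
qed

lemma nn_integral_inverse_near_0:
  assumes "0 < T"
  shows "(\<integral>\<^sup>+t\<in>{0<..<T}. ennreal (t powr -1) \<partial>lebesgue_on {0<..}) = top"
proof -
  have "ennreal r \<le> (\<integral>\<^sup>+t\<in>{0<..<T}. ennreal (t powr -1) \<partial>lebesgue_on {0<..})" if "0 \<le> r" for r
  proof -
    \<comment> \<open>The endpoints are chosen so that the integral of 1/t between them is exactly
      r.\<close>
    have "ennreal r = (\<integral>\<^sup>+t\<in>{T/2 * exp (-r)..T/2}. ennreal (t powr -1) \<partial>lborel)"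
      using assms that by (subst nn_integral_inverse_Icc) (auto simp: ln_mult ln_div)
    also have "\<dots> \<le> (\<integral>\<^sup>+t\<in>{0<..<T}. ennreal (t powr -1) \<partial>lebesgue_on {0<..})"
      unfolding nn_integral_Ioi using assms
      by (intro nn_integral_mono) (auto simp: indicator_def intro: less_le_trans[of 0 "T/2 * exp (-r)"])
    finally show ?thesis .
  qed
  then show ?thesis
    by (rule ennreal_eq_topI)
qed

lemma nn_integral_inverse_near_inf:
  "(\<integral>\<^sup>+t\<in>{1<..}. ennreal (t powr -1) \<partial>lebesgue_on {0<..}) = top"
proof -
  have "ennreal r \<le> (\<integral>\<^sup>+t\<in>{1<..}. ennreal (t powr -1) \<partial>lebesgue_on {0<..})" if "0 \<le> r" for r
  proof -
    have "ennreal r = (\<integral>\<^sup>+t\<in>{2..2 * exp r}. ennreal (t powr -1) \<partial>lborel)"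
      using that by (subst nn_integral_inverse_Icc) (auto simp: ln_mult ln_div)
    also have "\<dots> \<le> (\<integral>\<^sup>+t\<in>{1<..}. ennreal (t powr -1) \<partial>lebesgue_on {0<..})"
      unfolding nn_integral_Ioi
      by (intro nn_integral_mono) (auto simp: indicator_def)
    finally show ?thesis .
  qed
  then show ?thesis
    by (rule ennreal_eq_topI)
qed

subsection \<open>The Lorentz--Karamata functional\<close>

definition lk_weight :: "ennreal \<Rightarrow> ennreal \<Rightarrow> (real \<Rightarrow> real) \<Rightarrow> real \<Rightarrow> ennreal" where
  "lk_weight p q b t = ennreal (t powr (recip p - recip q) * b t)"

definition rearr_average :: "'a measure \<Rightarrow> ('a \<Rightarrow> ennreal) \<Rightarrow> real \<Rightarrow> ennreal" where
  "rearr_average M u t = ennreal (1 / t) * rearr_integral M u (ennreal t)"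

lemma lk_norm_eq:
  assumes "f \<in> mfuns M"
  shows "lk_norm M p q b f = Lq_norm q (\<lambda>t. lk_weight p q b t * rearr_average M (\<lambda>x. ecmod (f x)) t)"
  using assms by (simp add: lk_norm_def lk_weight_def rearr_average_def max_rearr_eq)

lemma on_nonneg_lk_norm:
  assumes "u \<in> borel_measurable M"
  shows "on_nonneg (lk_norm M p q b) u = Lq_norm q (\<lambda>t. lk_weight p q b t * rearr_average M u t)"
  using assms by (simp add: on_nonneg_def lk_norm_eq)

lemma borel_measurable_lebesgue_on_Ioi:
  assumes "f \<in> borel_measurable borel"
  shows "f \<in> borel_measurable (lebesgue_on {0::real<..})"
  using assms by (intro measurable_restrict_space1 measurable_completion) simp

lemma lk_weight_measurable [measurable]:
  assumes "slowly_varying b"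
  shows "lk_weight p q b \<in> borel_measurable (lebesgue_on {0<..})"
proof -
  have [measurable]: "b \<in> borel_measurable (lebesgue_on {0<..})"
    using assms by (simp add: slowly_varying_def)
  have [measurable]: "(\<lambda>t::real. t) \<in> borel_measurable (lebesgue_on {0<..})"
    by (rule borel_measurable_lebesgue_on_Ioi) simp
  show ?thesis unfolding lk_weight_def by measurable
qed

lemma lk_weight_pos: "slowly_varying b \<Longrightarrow> 0 < t \<Longrightarrow> 0 < lk_weight p q b t"
  by (simp add: lk_weight_def slowly_varying_def)

lemma rearr_average_measurable [measurable]:
  assumes [measurable]: "u \<in> borel_measurable M"
  shows "rearr_average M u \<in> borel_measurable (lebesgue_on {0<..})"
proof (rule borel_measurable_lebesgue_on_Ioi)
  have [measurable]: "(\<lambda>t::real. rearr_integral M u (ennreal t)) \<in> borel_measurable borel"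
    unfolding rearr_integral_def by measurable
  show "rearr_average M u \<in> borel_measurable borel"
    unfolding rearr_average_def by measurable
qed

lemma rearr_average_mono_AE:
  assumes "v \<in> borel_measurable M" "AE x in M. u x \<le> v x"
  shows "rearr_average M u t \<le> rearr_average M v t"
  unfolding rearr_average_def by (intro mult_left_mono rearr_integral_mono_AE assms) auto

lemma rearr_average_antimono:
  assumes "u \<in> borel_measurable M" "0 < s" "s \<le> t"
  shows "rearr_average M u t \<le> rearr_average M u s"
proof -
  have "ennreal (1 / (s * t)) * (ennreal s * rearr_integral M u (ennreal t))
      \<le> ennreal (1 / (s * t)) * (ennreal t * rearr_integral M u (ennreal s))"
    using assms by (intro mult_left_mono rearr_integral_quotient_antimono ennreal_leI) auto
  then show ?thesis
    using assms unfolding rearr_average_def by (simp add: mult.assoc[symmetric] ennreal_mult[symmetric])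
qed

lemma rearr_average_indicator:
  assumes "E \<in> sets M"
  shows "rearr_average M (indicator E) t = ennreal (1 / t) * min (ennreal t) (emeasure M E)"
  using assms by (simp add: rearr_average_def rearr_integral_indicator)

section \<open>Weights of finite norm at the two ends of the half-line\<close>

lemma recip_top [simp]: "recip top = 0"
  by (simp add: recip_def)

lemma recip_one [simp]: "recip 1 = 1"
  by (simp add: recip_def)

lemma recip_ennreal: "0 < r \<Longrightarrow> recip (ennreal r) = 1 / r"
  by (simp add: recip_def divide_ennreal flip: ennreal_1)

lemma recip_pos: "0 < p \<Longrightarrow> p < top \<Longrightarrow> 0 < recip p"
  by (cases p) (auto simp: recip_ennreal)

lemma ennreal_pos_cases:
  assumes "0 < q"
  obtains "q = top" | r where "0 < r" "q = ennreal r"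
  using assms by (cases q) auto

lemma Lq_norm_ennreal:
  "0 < r \<Longrightarrow> Lq_norm (ennreal r) f = ennpowr (\<integral>\<^sup>+t. ennpowr (f t) r \<partial>lebesgue_on {0<..}) (1 / r)"
  by (simp add: Lq_norm_def)

text \<open>The exponent is split as e + e: one half absorbs b, and the other leaves t^(e - 1/q),
  whose q-th power is t^(e q - 1). The set S and the sign of e stay open so that (0, 1) with e > 0
  and (1, infinity) with e < 0 are treated at once.\<close>

lemma Lq_norm_powr_finite:
  fixes S :: "real set" and b :: "real \<Rightarrow> real"
  assumes q: "0 < q" and [measurable]: "b \<in> borel_measurable (lebesgue_on {0<..})"
    and S: "S \<in> sets borel" "S \<subseteq> {0<..}"
    and b: "\<And>t. t \<in> S \<Longrightarrow> 0 \<le> b t \<and> b t \<le> K * t powr (-e)" and "0 \<le> K"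
    and e: "\<And>t. t \<in> S \<Longrightarrow> t powr e \<le> 1"
    and int: "\<And>r. 0 < r \<Longrightarrow> (\<integral>\<^sup>+t\<in>S. ennreal (t powr (e * r - 1)) \<partial>lebesgue_on {0<..}) < top"
  shows "Lq_norm q (\<lambda>t. ennreal (t powr (2 * e - recip q) * b t) * indicator S t) < top"
proof -
  have [measurable]: "(\<lambda>t::real. t) \<in> borel_measurable (lebesgue_on {0<..})"
    by (rule borel_measurable_lebesgue_on_Ioi) simp
  have [measurable]: "(indicator S :: real \<Rightarrow> ennreal) \<in> borel_measurable (lebesgue_on {0<..})"
    using S by (intro borel_measurable_lebesgue_on_Ioi) simp
  have pw: "t powr (2 * e - recip q) * b t \<le> K * t powr (e - recip q)" if "t \<in> S" for t
  proof -
    have "t powr (2 * e - recip q) * b t \<le> t powr (2 * e - recip q) * (K * t powr (-e))"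
      using b[OF that] by (intro mult_left_mono) auto
    also have "\<dots> = K * (t powr (2 * e - recip q) * t powr (-e))" by (simp only: mult_ac)
    also have "\<dots> = K * t powr (e - recip q)" by (simp add: powr_add[symmetric])
    finally show ?thesis .
  qed
  show ?thesis
    using q
  proof (cases rule: ennreal_pos_cases)
    case 1
    have "AE t in lebesgue_on {0<..}. ennreal (t powr (2 * e - recip q) * b t) * indicator S t \<le> ennreal K"
    proof (intro AE_I2)
      fix t
      show "ennreal (t powr (2 * e - recip q) * b t) * indicator S t \<le> ennreal K"
      proof (cases "t \<in> S")
        case True
        have "t powr (2 * e - recip q) * b t \<le> K * t powr e" using pw[OF True] 1 by simp
        also have "\<dots> \<le> K * 1" using e[OF True] \<open>0 \<le> K\<close> by (rule mult_left_mono)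
        finally show ?thesis using True by (simp add: ennreal_leI)
      qed simp
    qed
    then have "esssup (lebesgue_on {0<..}) (\<lambda>t. ennreal (t powr (2 * e - recip q) * b t) * indicator S t) \<le> ennreal K"
      by (intro esssup_I) measurable
    then show ?thesis using 1 by (auto simp: Lq_norm_def intro: le_less_trans)
  next
    case (2 r)
    have "(\<integral>\<^sup>+t. ennpowr (ennreal (t powr (2 * e - recip q) * b t) * indicator S t) r \<partial>lebesgue_on {0<..})
        \<le> (\<integral>\<^sup>+t. ennreal (K powr r) * (ennreal (t powr (e * r - 1)) * indicator S t) \<partial>lebesgue_on {0<..})"
    proof (intro nn_integral_mono)
      fix t
      show "ennpowr (ennreal (t powr (2 * e - recip q) * b t) * indicator S t) r
          \<le> ennreal (K powr r) * (ennreal (t powr (e * r - 1)) * indicator S t)"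
      proof (cases "t \<in> S")
        case True
        then have "0 < t" using S by auto
        have "(t powr (2 * e - recip q) * b t) powr r \<le> (K * t powr (e - recip q)) powr r"
          using pw[OF True] b[OF True] 2 by (intro powr_mono2) auto
        also have "\<dots> = K powr r * t powr ((e - recip q) * r)"
          using \<open>0 \<le> K\<close> by (simp add: powr_mult powr_powr)
        also have "(e - recip q) * r = e * r - 1" using 2 by (simp add: recip_ennreal field_simps)
        finally show ?thesis
          using True b[OF True] by (simp add: ennpowr_ennreal ennreal_mult[symmetric] ennreal_leI)
      qed simp
    qed
    also have "\<dots> = ennreal (K powr r) * (\<integral>\<^sup>+t\<in>S. ennreal (t powr (e * r - 1)) \<partial>lebesgue_on {0<..})"
      by (subst nn_integral_cmult) auto
    also have "\<dots> < top" using int[OF 2(1)] by (simp add: ennreal_mult_less_top)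
    finally show ?thesis using 2 by (simp add: Lq_norm_ennreal ennpowr_less_top_iff)
  qed
qed

lemma Lq_norm_powr_near_0_finite:
  assumes sv: "slowly_varying b" and "0 < a" "0 < q"
  shows "Lq_norm q (\<lambda>t. ennreal (t powr (a - recip q) * b t) * indicator {0<..<1} t) < top"
proof -
  obtain K where K: "0 < K" "\<And>t. 0 < t \<Longrightarrow> t \<le> 1 \<Longrightarrow> b t \<le> K * t powr (-(a/2))"
    using slowly_varying_bounds[OF sv, of "a/2"] \<open>0 < a\<close> by auto
  have "Lq_norm q (\<lambda>t. ennreal (t powr (2 * (a/2) - recip q) * b t) * indicator {0<..<1} t) < top"
  proof (rule Lq_norm_powr_finite[where K = K])
    show "t powr (a / 2) \<le> 1" if "t \<in> {0<..<1}" for t :: real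
      using powr_mono2[of "a/2" t 1] that \<open>0 < a\<close> by simp
    show "(\<integral>\<^sup>+t\<in>{0<..<1}. ennreal (t powr (a / 2 * r - 1)) \<partial>lebesgue_on {0<..}) < top" if "0 < r" for r
      using that \<open>0 < a\<close> by (intro nn_integral_powr_near_0) simp
  qed (use K sv \<open>0 < q\<close> in \<open>auto simp: slowly_varying_def less_imp_le\<close>)
  then show ?thesis by simp
qed

lemma Lq_norm_powr_near_inf_finite:
  assumes sv: "slowly_varying b" and "a < 0" "0 < q"
  shows "Lq_norm q (\<lambda>t. ennreal (t powr (a - recip q) * b t) * indicator {1<..} t) < top"
proof -
  obtain K where K: "0 < K" "\<And>t. 0 < t \<Longrightarrow> 1 \<le> t \<Longrightarrow> b t \<le> K * t powr (-(a/2))"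
    using slowly_varying_bounds[OF sv, of "-(a/2)"] \<open>a < 0\<close> by auto
  have "Lq_norm q (\<lambda>t. ennreal (t powr (2 * (a/2) - recip q) * b t) * indicator {1<..} t) < top"
  proof (rule Lq_norm_powr_finite[where K = K])
    show "t powr (a / 2) \<le> 1" if "t \<in> {1<..}" for t :: real
      using powr_mono[of "a/2" 0 t] that \<open>a < 0\<close> by simp
    show "(\<integral>\<^sup>+t\<in>{1<..}. ennreal (t powr (a / 2 * r - 1)) \<partial>lebesgue_on {0<..}) < top" if "0 < r" for r
      using that \<open>a < 0\<close> by (intro nn_integral_powr_near_inf) (simp add: mult_neg_pos)
  qed (use K sv \<open>0 < q\<close> in \<open>auto simp: slowly_varying_def less_imp_le\<close>)
  then show ?thesis by simp
qed

section \<open>The norm axioms for the Lorentz-Karamata functional\<close>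

lemma rearr_average_add:
  assumes "sigma_finite_measure M" "u \<in> borel_measurable M" "v \<in> borel_measurable M" "0 < t"
  shows "rearr_average M (\<lambda>x. u x + v x) t \<le> rearr_average M u t + rearr_average M v t"
  unfolding rearr_average_def distrib_left[symmetric]
  using assms by (intro mult_left_mono rearr_integral_add) auto

lemma rearr_average_cmult:
  assumes "u \<in> borel_measurable M" "0 \<le> a"
  shows "rearr_average M (\<lambda>x. ennreal a * u x) t = ennreal a * rearr_average M u t"
  using assms by (simp add: rearr_average_def rearr_integral_cmult mult_ac)

lemma rearr_average_SUP:
  assumes "\<And>n::nat. u n \<in> borel_measurable M" "v \<in> borel_measurable M"
    and "AE x in M. incseq (\<lambda>n. u n x) \<and> (\<lambda>n. u n x) \<longlonglongrightarrow> v x"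
  shows "rearr_average M v t = (SUP n. rearr_average M (u n) t)"
  unfolding rearr_average_def by (simp add: rearr_integral_SUP[OF assms] SUP_mult_left_ennreal)

lemma lk_weight_mult_inverse:
  assumes "0 < t"
  shows "lk_weight p q b t * ennreal (1 / t) = ennreal (t powr (recip p - 1 - recip q) * b t)"
proof -
  have "t powr (recip p - 1 - recip q) = t powr (recip p - recip q) * (1 / t)"
    using assms by (simp add: powr_diff)
  then show ?thesis
    using assms unfolding lk_weight_def
    by (subst ennreal_mult''[symmetric]) (simp_all add: mult_ac)
qed

lemma borel_measurable_Ioi_indicator [measurable]:
  "S \<in> sets borel \<Longrightarrow> (indicator S :: real \<Rightarrow> ennreal) \<in> borel_measurable (lebesgue_on {0<..})"
  by (intro borel_measurable_lebesgue_on_Ioi) simp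

lemma borel_measurable_Ioi_inverse [measurable]:
  "(\<lambda>t. ennreal (1 / t)) \<in> borel_measurable (lebesgue_on {0<..})"
  by (intro borel_measurable_lebesgue_on_Ioi) measurable

lemma AE_Ioi: "AE t in lebesgue_on {0<..}. 0 < (t::real)"
  by (auto intro!: AE_I2)

lemma AE_Ioi_neq: "AE t in lebesgue_on {0<..}. t \<noteq> (c::real)"
proof -
  have "AE t in lebesgue. t \<noteq> c" by (intro AE_completion AE_lborel_singleton)
  then show ?thesis by (auto simp: AE_restrict_space_iff)
qed

text \<open>The average of the indicator is at most 1 and at most mu(E)/t. The first bound is used
  on (0, 1) and the second on (1, infinity). The remaining weight norms are finite by power
  estimates, except at the borderline p = infinity near zero and p = 1 near infinity, where
  admissibility assumes exactly what is needed.\<close>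

lemma lk_norm_indicator_finite:
  assumes sv: "slowly_varying b" and adm: "lk_admissible p q b"
    and [measurable]: "E \<in> sets M" and fin: "emeasure M E < top"
  shows "on_nonneg (lk_norm M p q b) (indicator E) < top"
proof -
  note [measurable] = lk_weight_measurable[OF sv]
  have q: "1 \<le> q" using adm by (simp add: lk_admissible_def)
  then have q0: "0 < q" by (rule less_le_trans[rotated]) simp
  let ?f = "\<lambda>t. lk_weight p q b t * indicator {0<..<1} t"
  let ?g = "\<lambda>t. lk_weight p q b t * ennreal (1 / t) * indicator {1<..} t"
  have f: "Lq_norm q ?f < top"
  proof (cases "p = top")
    case True
    with adm show ?thesis by (simp add: lk_admissible_def lk_weight_def)
  next
    case False
    with adm have "0 < p" by (auto simp: lk_admissible_def intro: less_trans[of 0 1 p])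
    with False have "0 < recip p" by (simp add: recip_pos less_top)
    then show ?thesis using Lq_norm_powr_near_0_finite[OF sv _ q0] by (simp add: lk_weight_def)
  qed
  have "Lq_norm q (\<lambda>t. ennreal (t powr (recip p - 1 - recip q) * b t) * indicator {1<..} t) < top"
  proof (cases "p = 1")
    case True
    with adm show ?thesis by (simp add: lk_admissible_def)
  next
    case False
    have "recip p < 1"
    proof (cases p)
      case (real r)
      with adm False have "1 < r" by (auto simp: lk_admissible_def)
      with real show ?thesis by (simp add: recip_ennreal)
    qed simp
    then show ?thesis using Lq_norm_powr_near_inf_finite[OF sv _ q0, of "recip p - 1"] by simp
  qed
  also have "Lq_norm q (\<lambda>t. ennreal (t powr (recip p - 1 - recip q) * b t) * indicator {1<..} t) = Lq_norm q ?g"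
  proof -
    have "(\<lambda>t. ennreal (t powr (recip p - 1 - recip q) * b t) * indicator {1<..} t) = ?g"
    proof
      show "ennreal (t powr (recip p - 1 - recip q) * b t) * indicator {1<..} t = ?g t" for t
        by (cases "0 < t") (auto simp: lk_weight_mult_inverse)
    qed
    then show ?thesis by simp
  qed
  finally have g: "Lq_norm q ?g < top" .
  have "on_nonneg (lk_norm M p q b) (indicator E)
      \<le> Lq_norm q (\<lambda>t. ?f t + emeasure M E * ?g t)"
    unfolding on_nonneg_lk_norm[OF borel_measurable_indicator[OF assms(3)]]
  proof (rule Lq_norm_mono)
    \<comment> \<open>The point t = 1 belongs to neither piece and is discarded as a null
      set.\<close>
    show "AE t in lebesgue_on {0<..}. lk_weight p q b t * rearr_average M (indicator E) t \<le> ?f t + emeasure M E * ?g t"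
      using AE_Ioi AE_Ioi_neq[of 1]
    proof eventually_elim
      fix t :: real assume t: "0 < t" "t \<noteq> 1"
      have "rearr_average M (indicator E) t \<le> 1"
      proof -
        have "rearr_average M (indicator E) t \<le> ennreal (1 / t) * ennreal t"
          by (simp add: rearr_average_indicator mult_left_mono)
        with t show ?thesis by (simp add: ennreal_mult[symmetric])
      qed
      moreover have "rearr_average M (indicator E) t \<le> ennreal (1 / t) * emeasure M E"
        by (simp add: rearr_average_indicator mult_left_mono)
      ultimately show "lk_weight p q b t * rearr_average M (indicator E) t \<le> ?f t + emeasure M E * ?g t"
        using t mult_left_mono[of "rearr_average M (indicator E) t" _ "lk_weight p q b t"]
        by (cases "t < 1") (force simp: mult_ac)+
    qed
  qed (use q0 in measurable)
  also have "\<dots> \<le> Lq_norm q ?f + Lq_norm q (\<lambda>t. emeasure M E * ?g t)"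
    by (intro Lq_norm_triangle q) measurable
  also have "\<dots> = Lq_norm q ?f + emeasure M E * Lq_norm q ?g"
    by (subst Lq_norm_cmult) (use q0 in measurable)
  also have "\<dots> < top" using f g fin by (simp add: ennreal_mult_less_top)
  finally show ?thesis .
qed

lemma rearr_average_eq_0D:
  assumes "u \<in> borel_measurable M" "rearr_average M u t = 0" "0 < t"
  shows "AE x in M. u x = 0"
proof -
  have "rearr_integral M u (ennreal t) = 0" using assms(2,3) by (simp add: rearr_average_def)
  then show ?thesis by (rule rearr_integral_eq_0D[OF assms(1)]) (use assms(3) in simp)
qed

lemma not_AE_Ioi_subset:
  assumes "0 < (T::real)"
  shows "\<not> (AE t in lebesgue_on {0<..}. \<not> t < T)"
proof
  assume "AE t in lebesgue_on {0<..}. \<not> t < T"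
  then have "AE t in lebesgue. t \<notin> {0<..<T}" by (simp add: AE_restrict_space_iff)
  then have "{0<..<T} \<in> null_sets lebesgue" by (intro AE_iff_null_sets[THEN iffD2]) auto
  with assms show False by (simp add: null_sets_def)
qed

text \<open>Let r = mu(E). Averages decrease, so on (0, r) they are at least the average at r; hence
  the functional is at least that value times the norm k of the weight on (0, r). The integral over
  E is at most r times the same value, which gives the constant r/k.\<close>

lemma lk_norm_integral_bound:
  assumes sf: "sigma_finite_measure M" and sv: "slowly_varying b" and q0: "0 < q"
    and [measurable]: "E \<in> sets M" and fin: "emeasure M E < top"
  shows "\<exists>C\<ge>0. \<forall>u\<in>borel_measurable M. (\<integral>\<^sup>+x\<in>E. u x \<partial>M) \<le> ennreal C * on_nonneg (lk_norm M p q b) u"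
proof (cases "emeasure M E = 0")
  case True
  have "(\<integral>\<^sup>+x\<in>E. u x \<partial>M) = 0" if [measurable]: "u \<in> borel_measurable M" for u
    using set_nn_integral_le_rearr_integral[OF sf that assms(4)] True by (simp add: rearr_integral_def)
  then show ?thesis by (intro exI[of _ 0]) auto
next
  case False
  note [measurable] = lk_weight_measurable[OF sv]
  obtain r where r: "0 < r" "emeasure M E = ennreal r" using fin False by (cases "emeasure M E") (auto simp: less_le)
  define k where "k = Lq_norm q (\<lambda>t. lk_weight p q b t * indicator {0<..<r} t)"
  have "k \<noteq> 0"
  proof
    assume "k = 0"
    then have "AE t in lebesgue_on {0<..}. lk_weight p q b t * indicator {0<..<r} t = 0"
      unfolding k_def using q0 by (subst (asm) Lq_norm_eq_0_iff) auto
    then have "AE t in lebesgue_on {0<..}. \<not> t < r"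
      using AE_Ioi
    proof eventually_elim
      fix t :: real assume "lk_weight p q b t * indicator {0<..<r} t = 0" "0 < t"
      then show "\<not> t < r" using lk_weight_pos[OF sv, of t p q] by (auto simp: indicator_def)
    qed
    with not_AE_Ioi_subset[OF r(1)] show False by simp
  qed
  have bound: "rearr_average M u r * k \<le> on_nonneg (lk_norm M p q b) u"
    and int: "(\<integral>\<^sup>+x\<in>E. u x \<partial>M) \<le> ennreal r * rearr_average M u r"
    if [measurable]: "u \<in> borel_measurable M" for u
  proof -
    have "rearr_average M u r * k
        = Lq_norm q (\<lambda>t. rearr_average M u r * (lk_weight p q b t * indicator {0<..<r} t))"
      unfolding k_def using q0 by (subst Lq_norm_cmult) auto
    also have "\<dots> \<le> on_nonneg (lk_norm M p q b) u"
      unfolding on_nonneg_lk_norm[OF that]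
    proof (rule Lq_norm_mono)
      have "rearr_average M u r * (lk_weight p q b t * indicator {0<..<r} t)
          \<le> lk_weight p q b t * rearr_average M u t" for t
        using rearr_average_antimono[OF that, of t r]
        by (cases "t \<in> {0<..<r}") (auto simp: mult.commute intro: mult_right_mono)
      then show "AE t in lebesgue_on {0<..}. rearr_average M u r * (lk_weight p q b t * indicator {0<..<r} t)
          \<le> lk_weight p q b t * rearr_average M u t" by simp
    qed (use q0 in measurable)
    finally show "rearr_average M u r * k \<le> on_nonneg (lk_norm M p q b) u" .
    have "ennreal r * rearr_average M u r = rearr_integral M u (ennreal r)"
      using r(1) by (simp add: rearr_average_def mult.assoc[symmetric] ennreal_mult[symmetric])
    then show "(\<integral>\<^sup>+x\<in>E. u x \<partial>M) \<le> ennreal r * rearr_average M u r"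
      using set_nn_integral_le_rearr_integral[OF sf that assms(4)] by (simp add: r)
  qed
  show ?thesis
  proof (cases k)
    case (real k')
    with \<open>k \<noteq> 0\<close> have k': "0 < k'" by (auto simp: less_le)
    have "(\<integral>\<^sup>+x\<in>E. u x \<partial>M) \<le> ennreal (r / k') * on_nonneg (lk_norm M p q b) u"
      if u: "u \<in> borel_measurable M" for u
    proof -
      have "ennreal r * rearr_average M u r = ennreal (r / k') * ennreal k' * rearr_average M u r"
        using r(1) k' by (simp add: ennreal_mult[symmetric])
      also have "\<dots> \<le> ennreal (r / k') * on_nonneg (lk_norm M p q b) u"
        using bound[OF u] real by (simp add: mult.assoc mult.commute[of "ennreal k'"] mult_left_mono)
      finally show ?thesis using int[OF u] by (rule order_trans[rotated])
    qed
    then show ?thesis using r(1) k' by (intro exI[of _ "r / k'"]) auto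
  next
    \<comment> \<open>With k infinite, either the average at r is zero or the functional is
      infinite, so any positive constant works.\<close>
    case top
    have "(\<integral>\<^sup>+x\<in>E. u x \<partial>M) \<le> ennreal 1 * on_nonneg (lk_norm M p q b) u"
      if u: "u \<in> borel_measurable M" for u
      using bound[OF u] int[OF u] top
      by (cases "rearr_average M u r = 0") (auto simp: ennreal_mult_top top_unique)
    then show ?thesis by (intro exI[of _ 1]) auto
  qed
qed

theorem lk_norm_banach_function_norm:
  fixes M :: "'a measure"
  assumes sf: "sigma_finite_measure M" and sv: "slowly_varying b" and adm: "lk_admissible p q b"
  shows "banach_function_norm M (lk_norm M p q b)"
proof -
  note [measurable] = lk_weight_measurable[OF sv]
  have q: "1 \<le> q" using adm by (simp add: lk_admissible_def)
  then have q0: "0 < q" by (rule less_le_trans[rotated]) simp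
  let ?N = "on_nonneg (lk_norm M p q b)"
  have mono: "?N u \<le> ?N v"
    if [measurable]: "u \<in> borel_measurable M" "v \<in> borel_measurable M" and "AE x in M. u x \<le> v x" for u v
    unfolding on_nonneg_lk_norm[OF that(1)] on_nonneg_lk_norm[OF that(2)] using q0
    by (intro Lq_norm_mono AE_I2 mult_left_mono rearr_average_mono_AE that) auto
  show ?thesis
    unfolding banach_function_norm_def
  proof (intro conjI ballI allI impI)
    fix f assume "f \<in> mfuns M"
    then show "lk_norm M p q b f = ?N (\<lambda>x. ecmod (f x))" by (simp add: on_nonneg_lk_norm lk_norm_eq)
  next
    fix a :: real and u :: "'a \<Rightarrow> ennreal" assume [measurable]: "u \<in> borel_measurable M" and "0 \<le> a"
    then show "?N (\<lambda>x. ennreal a * u x) = ennreal a * ?N u"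
      using q0 by (simp add: on_nonneg_lk_norm rearr_average_cmult Lq_norm_cmult[symmetric] mult_ac)
  next
    fix u v :: "'a \<Rightarrow> ennreal" assume [measurable]: "u \<in> borel_measurable M" "v \<in> borel_measurable M"
    have "?N (\<lambda>x. u x + v x)
        \<le> Lq_norm q (\<lambda>t. lk_weight p q b t * rearr_average M u t + lk_weight p q b t * rearr_average M v t)"
      using q0 by (simp add: on_nonneg_lk_norm, intro Lq_norm_mono)
        (auto intro!: AE_I2 mult_left_mono rearr_average_add sf simp: distrib_left[symmetric])
    also have "\<dots> \<le> ?N u + ?N v"
      using q by (simp add: on_nonneg_lk_norm Lq_norm_triangle)
    finally show "?N (\<lambda>x. u x + v x) \<le> ?N u + ?N v" .
  next
    fix u :: "'a \<Rightarrow> ennreal" assume u[measurable]: "u \<in> borel_measurable M"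
    show "?N u = 0 \<longleftrightarrow> (AE x in M. u x = 0)"
    proof
      assume "?N u = 0"
      then have "AE t in lebesgue_on {0<..}. lk_weight p q b t * rearr_average M u t = 0"
        using q0 by (simp add: on_nonneg_lk_norm Lq_norm_eq_0_iff)
      then have ae: "AE t in lebesgue_on {0<..}. rearr_average M u t = 0 \<and> 0 < t"
        using AE_Ioi
      proof eventually_elim
        fix t :: real assume "lk_weight p q b t * rearr_average M u t = 0" "0 < t"
        then show "rearr_average M u t = 0 \<and> 0 < t" using lk_weight_pos[OF sv, of t p q] by auto
      qed
      \<comment> \<open>Vanishing for almost every t is used only through one positive t, which
        already forces u = 0.\<close>
      have "\<exists>t. rearr_average M u t = 0 \<and> 0 < t"
      proof (rule ccontr)
        assume none: "\<not> ?thesis"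
        have "AE t in lebesgue_on {0::real<..}. \<not> t < 1"
          using ae by (rule eventually_mono) (use none in blast)
        with not_AE_Ioi_subset[of 1] show False by simp
      qed
      then obtain t where "rearr_average M u t = 0" "0 < t" by blast
      then show "AE x in M. u x = 0" by (rule rearr_average_eq_0D[OF u])
    next
      assume "AE x in M. u x = 0"
      \<comment> \<open>The zero function is written as 0 * u, so that homogeneity of the average
        evaluates it.\<close>
      then have "?N u \<le> ?N (\<lambda>x. ennreal 0 * u x)" by (intro mono) (auto elim!: eventually_mono)
      also have "\<dots> = 0"
        using q0 rearr_average_cmult[OF u, of 0] by (simp add: on_nonneg_lk_norm Lq_norm_eq_0_iff)
      finally show "?N u = 0" by simp
    qed
  next
    fix u v :: "'a \<Rightarrow> ennreal" assume "u \<in> borel_measurable M" "v \<in> borel_measurable M" "AE x in M. u x \<le> v x"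
    then show "?N u \<le> ?N v" by (rule mono)
  next
    fix u :: "nat \<Rightarrow> 'a \<Rightarrow> ennreal" and v
    assume u: "\<forall>n. u n \<in> borel_measurable M" and v: "v \<in> borel_measurable M"
      and conv: "AE x in M. incseq (\<lambda>n. u n x) \<and> (\<lambda>n. u n x) \<longlonglongrightarrow> v x"
    note [measurable] = u[rule_format] v
    have le: "AE x in M. u m x \<le> u n x" if "m \<le> n" for m n
      using conv by eventually_elim (use that in \<open>auto dest: incseqD\<close>)
    show inc: "incseq (\<lambda>n. ?N (u n))" by (auto simp: incseq_def intro!: mono le)
    have "?N v = Lq_norm q (\<lambda>t. SUP n. lk_weight p q b t * rearr_average M (u n) t)"
      using rearr_average_SUP[OF _ v conv] by (simp add: on_nonneg_lk_norm SUP_mult_left_ennreal)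
    also have "\<dots> = (SUP n. ?N (u n))"
      using q0 by (subst Lq_norm_SUP)
        (auto simp: incseq_def le_fun_def on_nonneg_lk_norm intro!: mult_left_mono rearr_average_mono_AE le)
    finally show "(\<lambda>n. ?N (u n)) \<longlonglongrightarrow> ?N v" using LIMSEQ_SUP[OF inc] by simp
  next
    fix E assume "E \<in> sets M" "emeasure M E < \<infinity>"
    then show "?N (indicator E) < \<infinity>" using lk_norm_indicator_finite[OF sv adm] by simp
  next
    fix E assume "E \<in> sets M" "emeasure M E < \<infinity>"
    then show "\<exists>C\<ge>0. \<forall>u\<in>borel_measurable M. (\<integral>\<^sup>+x\<in>E. u x \<partial>M) \<le> ennreal C * ?N u"
      using lk_norm_integral_bound[OF sf sv q0] by simp
  qed
qed

subsection \<open>Necessity of the conditions on the first exponent\<close>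

lemma rearr_average_indicator_real:
  assumes "E \<in> sets M" "emeasure M E = ennreal r" "0 \<le> r" "0 < t"
  shows "rearr_average M (indicator E) t = ennreal (min 1 (r / t))"
proof -
  have "min (ennreal t) (ennreal r) = ennreal (min t r)" using assms by (simp add: min_def ennreal_le_iff)
  moreover have "1 / t * min t r = min 1 (r / t)" using assms by (auto simp: min_def field_simps)
  ultimately show ?thesis
    using assms by (simp add: rearr_average_indicator ennreal_mult'[symmetric])
qed

lemma Lq_norm_finite_of_scaled_le:
  assumes [measurable]: "f \<in> borel_measurable (lebesgue_on {0<..})" and "0 < q"
    and k: "0 < k" and le: "\<And>t. 0 < t \<Longrightarrow> ennreal k * f t \<le> g t" and fin: "Lq_norm q g < top"
  shows "Lq_norm q f < top"
proof -
  have "ennreal k * Lq_norm q f = Lq_norm q (\<lambda>t. ennreal k * f t)"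
    using assms(2) by (simp add: Lq_norm_cmult)
  also have "\<dots> \<le> Lq_norm q g"
    using assms(2) le by (intro Lq_norm_mono AE_I2) auto
  finally have "ennreal k * Lq_norm q f < top" using fin by (rule le_less_trans)
  with k show ?thesis by (auto simp: ennreal_mult_less_top)
qed

text \<open>With r = mu(E), the average min(1, r/t) is at least min(1, r/T) on (0, T) and at least
  min(T, r)/t on (T, infinity). One set of positive finite measure thus controls both ends of the
  weight, for every cut T.\<close>

lemma lk_norm_indicator_finiteD:
  assumes sv: "slowly_varying b" and q0: "0 < q" and E: "E \<in> sets M" "0 < emeasure M E" "emeasure M E < top"
    and fin: "on_nonneg (lk_norm M p q b) (indicator E) < top" and T: "0 < T"
  shows "Lq_norm q (\<lambda>t. lk_weight p q b t * indicator {0<..<T} t) < top"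
    and "Lq_norm q (\<lambda>t. lk_weight p q b t * ennreal (1 / t) * indicator {T<..} t) < top"
proof -
  note [measurable] = lk_weight_measurable[OF sv] E(1)
  obtain r where r: "0 < r" "emeasure M E = ennreal r" using E by (cases "emeasure M E") auto
  note avg = rearr_average_indicator_real[OF E(1) r(2)]
  have N: "Lq_norm q (\<lambda>t. lk_weight p q b t * rearr_average M (indicator E) t) < top"
    using fin by (simp add: on_nonneg_lk_norm)
  show "Lq_norm q (\<lambda>t. lk_weight p q b t * indicator {0<..<T} t) < top"
  proof (rule Lq_norm_finite_of_scaled_le[OF _ q0 _ _ N, where k = "min 1 (r / T)"])
    fix t :: real assume t: "0 < t"
    show "ennreal (min 1 (r / T)) * (lk_weight p q b t * indicator {0<..<T} t)
        \<le> lk_weight p q b t * rearr_average M (indicator E) t"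
    proof (cases "t < T")
      case True
      then have "r / T \<le> r / t" using r t by (intro divide_left_mono) auto
      then have "ennreal (min 1 (r / T)) \<le> ennreal (min 1 (r / t))" by (intro ennreal_leI) auto
      then show ?thesis
        using True t r by (simp add: avg mult.commute mult_left_mono)
    qed simp
  qed (use r T in simp_all)
  show "Lq_norm q (\<lambda>t. lk_weight p q b t * ennreal (1 / t) * indicator {T<..} t) < top"
  proof (rule Lq_norm_finite_of_scaled_le[OF _ q0 _ _ N, where k = "min T r"])
    fix t :: real assume t: "0 < t"
    show "ennreal (min T r) * (lk_weight p q b t * ennreal (1 / t) * indicator {T<..} t)
        \<le> lk_weight p q b t * rearr_average M (indicator E) t"
    proof (cases "T < t")
      case True
      have "ennreal (min T r) * ennreal (1 / t) = ennreal (min T r * (1 / t))"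
        using r T t by (intro ennreal_mult[symmetric]) auto
      also have "\<dots> \<le> ennreal (min 1 (r / t))"
        using True r T t by (intro ennreal_leI) (auto simp: min_def field_simps)
      finally have "lk_weight p q b t * (ennreal (min T r) * ennreal (1 / t)) \<le> lk_weight p q b t * ennreal (min 1 (r / t))"
        by (rule mult_left_mono) simp
      then show ?thesis
        using True t r by (simp add: avg mult_ac)
    qed simp
  qed (use r T in simp_all)
qed

text \<open>The lower bound for b cancels t^a and leaves t^(-1/r), whose r-th power 1/t has infinite
  integral over S. The exponent a may have either sign: a > 0 is used near infinity and a = -1 near
  zero.\<close>

lemma Lq_norm_powr_infinite:
  fixes b :: "real \<Rightarrow> real"
  assumes r: "0 < r" and S: "S \<subseteq> {0<..}" and K: "0 < K"
    and b: "\<And>t. t \<in> S \<Longrightarrow> t powr (-a) \<le> K * b t"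
    and inf: "(\<integral>\<^sup>+t\<in>S. ennreal (t powr -1) \<partial>lebesgue_on {0<..}) = top"
    and [measurable]: "b \<in> borel_measurable (lebesgue_on {0<..})" "S \<in> sets borel"
  shows "(\<integral>\<^sup>+t. ennpowr (ennreal (t powr (a - recip (ennreal r)) * b t) * indicator S t) r \<partial>lebesgue_on {0<..}) = top"
    (is "?I = top")
proof -
  have [measurable]: "(\<lambda>t::real. t) \<in> borel_measurable (lebesgue_on {0<..})"
    by (rule borel_measurable_lebesgue_on_Ioi) simp
  have "top = (\<integral>\<^sup>+t\<in>S. ennreal (t powr -1) \<partial>lebesgue_on {0<..})" by (simp only: inf)
  also have "\<dots> \<le> (\<integral>\<^sup>+t. ennreal (K powr r) * ennpowr (ennreal (t powr (a - recip (ennreal r)) * b t) * indicator S t) r \<partial>lebesgue_on {0<..})"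
  proof (rule nn_integral_mono)
    fix t
    show "ennreal (t powr -1) * indicator S t
        \<le> ennreal (K powr r) * ennpowr (ennreal (t powr (a - recip (ennreal r)) * b t) * indicator S t) r"
    proof (cases "t \<in> S")
      case True
      then have t: "0 < t" using S by auto
      have "0 < t powr (-a)" using t by simp
      also have "\<dots> \<le> K * b t" by (rule b[OF True])
      finally have bt: "0 < b t" using K by (simp add: zero_less_mult_iff)
      have "t powr (-recip (ennreal r)) = t powr (a - recip (ennreal r)) * t powr (-a)"
        by (simp add: powr_add[symmetric])
      also have "\<dots> \<le> t powr (a - recip (ennreal r)) * (K * b t)"
        by (intro mult_left_mono b True) simp
      finally have "(t powr (-recip (ennreal r))) powr r \<le> (K * (t powr (a - recip (ennreal r)) * b t)) powr r"
        using r by (intro powr_mono2) (auto simp: mult_ac)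
      then have "t powr -1 \<le> K powr r * (t powr (a - recip (ennreal r)) * b t) powr r"
        using r K bt by (simp add: powr_powr recip_ennreal powr_mult)
      then show ?thesis
        using True bt by (simp add: ennpowr_ennreal ennreal_mult[symmetric] ennreal_leI)
    qed simp
  qed
  also have "\<dots> = ennreal (K powr r) * ?I"
    using r by (intro nn_integral_cmult) measurable
  finally show ?thesis using K by (cases ?I) (auto simp: ennreal_mult[symmetric] top_unique)
qed

text \<open>For q = infinity, t^a b(t) is at least a multiple of t^(a/2) and so is unbounded on sets
  of positive measure. For finite q, the integral of 1/t diverges.\<close>

lemma Lq_norm_powr_near_inf_infinite:
  assumes sv: "slowly_varying b" and "0 < a" and q0: "0 < q"
  shows "Lq_norm q (\<lambda>t. ennreal (t powr (a - recip q) * b t) * indicator {1<..} t) = top"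
  using q0
proof (cases rule: ennreal_pos_cases)
  case 1
  have [measurable]: "b \<in> borel_measurable (lebesgue_on {0<..})" using sv by (simp add: slowly_varying_def)
  obtain K where K: "0 < K" "\<And>t. 1 \<le> t \<Longrightarrow> t powr (-(a/2)) \<le> K * b t"
    using slowly_varying_bounds[OF sv, of "a/2"] \<open>0 < a\<close> by auto
  let ?f = "\<lambda>t. ennreal (t powr a * b t) * indicator {1<..} t"
  show ?thesis
  proof (rule ccontr)
    assume "\<not> ?thesis"
    then have "esssup (lebesgue_on {0<..}) ?f \<noteq> top" using 1 by (simp add: Lq_norm_def)
    then obtain z where z: "0 \<le> z" "esssup (lebesgue_on {0<..}) ?f = ennreal z"
      by (cases "esssup (lebesgue_on {0<..}) ?f") auto
    \<comment> \<open>Beyond this point t^(a/2) is at least K z + 1, so t^a b(t) would exceed the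
      supposed bound z; the maximum with 1 keeps t in the range of the estimate for b.\<close>
    define T where "T = max 1 ((K * z + 1) powr (2 / a))"
    have "AE t in lebesgue_on {0<..}. ?f t \<le> ennreal z" unfolding z(2)[symmetric] by (rule esssup_AE)
    then have "AE t in lebesgue_on {0<..}. \<not> T < t"
    proof eventually_elim
      fix t assume t: "?f t \<le> ennreal z"
      show "\<not> T < t"
      proof
        assume "T < t"
        then have t1: "1 < t" and t2: "(K * z + 1) powr (2 / a) < t" by (auto simp: T_def)
        have "K * z + 1 = ((K * z + 1) powr (2 / a)) powr (a / 2)"
          using K z \<open>0 < a\<close> by (simp add: powr_powr add_nonneg_pos)
        also have "\<dots> \<le> t powr (a / 2)" using t2 \<open>0 < a\<close> by (intro powr_mono2) auto
        also have "\<dots> = t powr a * t powr (-(a / 2))" by (simp add: powr_add[symmetric])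
        also have "\<dots> \<le> t powr a * (K * b t)" using K(2)[of t] t1 by (intro mult_left_mono) auto
        also have "\<dots> = K * (t powr a * b t)" by simp
        also have "\<dots> \<le> K * z"
        proof (intro mult_left_mono)
          show "t powr a * b t \<le> z" using t t1 z by (simp add: ennreal_le_iff)
        qed (use K in simp)
        finally show False by simp
      qed
    qed
    then have "AE t in lebesgue. t \<notin> {T<..<T + 1}"
      by (auto simp: AE_restrict_space_iff T_def elim!: eventually_mono)
    then have "{T<..<T + 1} \<in> null_sets lebesgue" by (intro AE_iff_null_sets[THEN iffD2]) auto
    then show False by (simp add: null_sets_def)
  qed
next
  case (2 r)
  obtain K where K: "0 < K" "\<And>t. 1 \<le> t \<Longrightarrow> t powr (-a) \<le> K * b t"
    using slowly_varying_bounds[OF sv, of a] \<open>0 < a\<close> by auto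
  have "(\<integral>\<^sup>+t. ennpowr (ennreal (t powr (a - recip (ennreal r)) * b t) * indicator {1<..} t) r \<partial>lebesgue_on {0<..}) = top"
    using 2 K sv by (intro Lq_norm_powr_infinite[where K = K] nn_integral_inverse_near_inf) (auto simp: slowly_varying_def)
  then show ?thesis using 2 by (simp add: Lq_norm_ennreal)
qed

section \<open>Sets of large and of small measure, and the conditions on p\<close>

lemma ex_set_large_measure:
  assumes "sigma_finite_measure M" "emeasure M (space M) = \<infinity>"
  shows "\<exists>E\<in>sets M. ennreal c < emeasure M E \<and> emeasure M E < top"
proof -
  interpret sigma_finite_measure M by fact
  obtain A :: "nat \<Rightarrow> 'a set" where A: "range A \<subseteq> sets M" "(\<Union>i. A i) = space M"
    "\<And>i. emeasure M (A i) \<noteq> \<infinity>" "incseq A"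
    using sigma_finite_incseq by blast
  have top: "(SUP i. emeasure M (A i)) = top" using SUP_emeasure_incseq[OF A(1,4)] A(2) assms(2) by simp
  have "ennreal c < (SUP i. emeasure M (A i))" unfolding top by simp
  then obtain i where "ennreal c < emeasure M (A i)" by (auto simp: less_SUP_iff)
  with A show ?thesis by (auto simp: less_top)
qed

text \<open>Non-atomicity yields a strictly smaller subset B of E with positive measure, without
  control of its size. The smaller of B and E - B has at most half the measure of E, and halving is
  iterated.\<close>

lemma ex_set_small_measure:
  assumes "nonatomic M" "E0 \<in> sets M" "0 < emeasure M E0" "emeasure M E0 < top" "0 < \<epsilon>"
  shows "\<exists>E\<in>sets M. 0 < emeasure M E \<and> emeasure M E \<le> ennreal \<epsilon>"
proof -
  have halves: "\<exists>E\<in>sets M. 0 < emeasure M E \<and> 2 ^ n * emeasure M E \<le> emeasure M E0" for n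
  proof (induction n)
    case 0
    then show ?case using assms by auto
  next
    case (Suc n)
    then obtain E where E: "E \<in> sets M" "0 < emeasure M E" "2 ^ n * emeasure M E \<le> emeasure M E0" by blast
    then obtain B where B: "B \<in> sets M" "B \<subseteq> E" "0 < emeasure M B" "emeasure M B < emeasure M E"
      using assms(1) unfolding nonatomic_def by blast
    have sum: "emeasure M B + emeasure M (E - B) = emeasure M E"
      using B E by (subst plus_emeasure) (auto simp: Un_absorb1)
    with B have pos: "0 < emeasure M (E - B)" by (metis add_0_right not_gr_zero order_less_irrefl)
    have "\<exists>D\<in>sets M. 0 < emeasure M D \<and> 2 * emeasure M D \<le> emeasure M E"
    proof (cases "emeasure M B \<le> emeasure M (E - B)")
      case True
      then have "2 * emeasure M B \<le> emeasure M E"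
        unfolding sum[symmetric] mult_2 by (intro add_left_mono)
      with B show ?thesis by blast
    next
      case False
      then have "2 * emeasure M (E - B) \<le> emeasure M E"
        unfolding sum[symmetric] mult_2 by (intro add_right_mono) simp
      with B E pos show ?thesis by blast
    qed
    then obtain D where D: "D \<in> sets M" "0 < emeasure M D" "2 * emeasure M D \<le> emeasure M E" by blast
    have "2 ^ Suc n * emeasure M D = 2 ^ n * (2 * emeasure M D)" by (simp add: mult_ac)
    also have "\<dots> \<le> emeasure M E0" using mult_left_mono[OF D(3), of "2 ^ n"] E(3) by simp
    finally show ?case using D by blast
  qed
  obtain m where m: "0 < m" "emeasure M E0 = ennreal m" using assms by (cases "emeasure M E0") auto
  obtain n where n: "m / \<epsilon> < 2 ^ n" using real_arch_pow[of 2 "m / \<epsilon>"] by auto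
  obtain E where E: "E \<in> sets M" "0 < emeasure M E" "2 ^ n * emeasure M E \<le> ennreal m" using halves[of n] m by auto
  have "emeasure M E \<le> ennreal \<epsilon>"
  proof (rule ccontr)
    assume "\<not> ?thesis"
    then have "2 ^ n * ennreal \<epsilon> \<le> 2 ^ n * emeasure M E" by (intro mult_left_mono) auto
    also have "\<dots> \<le> ennreal m" by (rule E(3))
    finally have "ennreal (2 ^ n * \<epsilon>) \<le> ennreal m" using assms(5) by (simp add: ennreal_mult ennreal_power[symmetric])
    then show False using n m assms(5) by (simp add: ennreal_le_iff field_simps)
  qed
  with E show ?thesis by blast
qed

text \<open>For p < 1 the weight divided by t carries the positive power 1/p - 1, so its norm near
  infinity is infinite. For p = 1 and p = infinity the finite norm near infinity, respectively near
  zero, is literally the required condition.\<close>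

lemma lk_exponent_conditions:
  assumes sv: "slowly_varying b" and p0: "0 < p" and q0: "0 < q"
    and E: "E \<in> sets M" "0 < emeasure M E" "emeasure M E < top"
    and fin: "on_nonneg (lk_norm M p q b) (indicator E) < top"
  shows "(1 < p \<and> p < \<infinity>) \<or>
      (p = 1 \<and> Lq_norm q (\<lambda>t. ennreal (t powr (- recip q) * b t) * indicator {1<..} t) < \<infinity>) \<or>
      (p = \<infinity> \<and> Lq_norm q (\<lambda>t. ennreal (t powr (- recip q) * b t) * indicator {0<..<1} t) < \<infinity>)"
proof -
  note near_0 = lk_norm_indicator_finiteD(1)[OF sv q0 E fin, of 1]
  note near_inf = lk_norm_indicator_finiteD(2)[OF sv q0 E fin, of 1]
  have eq: "(\<lambda>t. lk_weight p q b t * ennreal (1 / t) * indicator {1<..} t)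
      = (\<lambda>t. ennreal (t powr (recip p - 1 - recip q) * b t) * indicator {1<..} t)"
  proof
    show "lk_weight p q b t * ennreal (1 / t) * indicator {1<..} t
      = ennreal (t powr (recip p - 1 - recip q) * b t) * indicator {1<..} t" for t
      by (cases "0 < t") (auto simp: lk_weight_mult_inverse)
  qed
  have "\<not> p < 1"
  proof
    assume "p < 1"
    then obtain s where s: "p = ennreal s" "0 < s" "s < 1" using p0 by (cases p) auto
    then have "0 < recip p - 1" by (simp add: recip_ennreal)
    then show False
      using Lq_norm_powr_near_inf_infinite[OF sv _ q0] near_inf unfolding eq by simp
  qed
  then consider "p = 1" | "1 < p" "p < top" | "p = top" by (cases "p = top") (force simp: less_top)+
  then show ?thesis
  proof cases
    case 1
    then show ?thesis using near_inf unfolding eq by simp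
  next
    case 3
    then show ?thesis using near_0 by (simp add: lk_weight_def)
  qed simp
qed

subsection \<open>Necessity of \<open>q \<ge> 1\<close>\<close>

lemma ennpowr_mult_indicator: "0 < a \<Longrightarrow> ennpowr (x * indicator S t) a = ennpowr x a * indicator S t"
  by (cases "t \<in> S") simp_all

text \<open>The integrand of the r-th power of the functional, for a finite exponent r. The escape
  argument is conducted with its integrals, because these add over disjoint parts of the
  half-line.\<close>

definition lk_density :: "'a measure \<Rightarrow> ennreal \<Rightarrow> real \<Rightarrow> (real \<Rightarrow> real) \<Rightarrow> ('a \<Rightarrow> ennreal) \<Rightarrow> real \<Rightarrow> ennreal" where
  "lk_density M p r b u t = ennpowr (lk_weight p (ennreal r) b t * rearr_average M u t) r"

lemma lk_density_measurable [measurable]: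
  assumes "slowly_varying b" "0 < r" and [measurable]: "u \<in> borel_measurable M"
  shows "lk_density M p r b u \<in> borel_measurable (lebesgue_on {0<..})"
proof -
  note [measurable] = lk_weight_measurable[OF assms(1)]
  show ?thesis unfolding lk_density_def using assms(2) by measurable
qed

lemma lk_density_mono:
  assumes "v \<in> borel_measurable M" "0 < r" "\<And>x. x \<in> space M \<Longrightarrow> u x \<le> v x"
  shows "lk_density M p r b u t \<le> lk_density M p r b v t"
  unfolding lk_density_def using assms
  by (intro ennpowr_mono mult_left_mono rearr_average_mono_AE AE_I2) auto

lemma lk_density_cmult:
  assumes "u \<in> borel_measurable M" "0 < r" "0 \<le> s"
  shows "lk_density M p r b (\<lambda>x. ennreal s * u x) t = ennreal (s powr r) * lk_density M p r b u t"
  using assms unfolding lk_density_def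
  by (simp add: rearr_average_cmult ennpowr_mult ennpowr_ennreal mult_ac)

lemma on_nonneg_lk_norm_eq_density:
  assumes "u \<in> borel_measurable M" "0 < r"
  shows "on_nonneg (lk_norm M p (ennreal r) b) u = ennpowr (\<integral>\<^sup>+t. lk_density M p r b u t \<partial>lebesgue_on {0<..}) (1 / r)"
  using assms by (simp add: on_nonneg_lk_norm Lq_norm_ennreal lk_density_def)

lemma nn_integral_exhaust:
  assumes [measurable]: "f \<in> borel_measurable (lebesgue_on {0<..})" "\<And>n::nat. A n \<in> sets borel"
    and inc: "incseq A" and cover: "{0::real<..} \<subseteq> (\<Union>n. A n)"
  shows "(\<integral>\<^sup>+t. f t \<partial>lebesgue_on {0<..}) = (SUP n. \<integral>\<^sup>+t\<in>A n. f t \<partial>lebesgue_on {0<..})"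
proof -
  have "(\<integral>\<^sup>+t. f t \<partial>lebesgue_on {0<..}) = (\<integral>\<^sup>+t. (SUP n. f t * indicator (A n) t) \<partial>lebesgue_on {0<..})"
  proof (rule nn_integral_cong)
    fix t :: real assume "t \<in> space (lebesgue_on {0<..})"
    with cover obtain n where "t \<in> A n" by auto
    then have "f t \<le> (SUP n. f t * indicator (A n) t)" by (intro SUP_upper2[of n]) auto
    moreover have "(SUP n. f t * indicator (A n) t) \<le> f t" by (intro SUP_least) (auto simp: indicator_def)
    ultimately show "f t = (SUP n. f t * indicator (A n) t)" by (rule antisym)
  qed
  also have "\<dots> = (SUP n. \<integral>\<^sup>+t\<in>A n. f t \<partial>lebesgue_on {0<..})"
  proof (rule nn_integral_monotone_convergence_SUP)
    show "incseq (\<lambda>n t. f t * indicator (A n) t)"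
      using inc by (auto simp: incseq_def le_fun_def indicator_def)
  qed measurable
  finally show ?thesis .
qed

text \<open>On (0, n+1) the density never exceeds the r-th power of the weight, whatever E is, so
  the early mass is at most the finite number \<open>H n\<close>. A set of measure above k+1 has
  average 1 on (0, k+1), so its total mass is at least \<open>H k\<close>, which tends to infinity
  because p is finite.\<close>

lemma large_sets_escape:
  assumes sf: "sigma_finite_measure M" and inf: "emeasure M (space M) = \<infinity>"
    and sv: "slowly_varying b" and p: "0 < p" "p < top" and r: "0 < r"
    and fin: "\<And>E. E \<in> sets M \<Longrightarrow> emeasure M E < top \<Longrightarrow> on_nonneg (lk_norm M p (ennreal r) b) (indicator E) < top"
  shows "\<exists>E\<in>sets M. emeasure M E < top \<and>
    1 + 2 * (\<integral>\<^sup>+t\<in>{..<real (Suc n)}. lk_density M p r b (indicator E) t \<partial>lebesgue_on {0<..})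
      \<le> (\<integral>\<^sup>+t. lk_density M p r b (indicator E) t \<partial>lebesgue_on {0<..})"
proof -
  note [measurable] = lk_weight_measurable[OF sv]
  let ?L = "lebesgue_on {0::real<..}"
  let ?W = "\<lambda>t. ennpowr (lk_weight p (ennreal r) b t) r"
  define H where "H = (\<lambda>n. \<integral>\<^sup>+t\<in>{..<real (Suc n)}. ?W t \<partial>?L)"
  have [measurable]: "?W \<in> borel_measurable ?L" using r by measurable
  have "Lq_norm (ennreal r) (\<lambda>t. lk_weight p (ennreal r) b t * indicator {1<..} t) = top"
    using Lq_norm_powr_near_inf_infinite[OF sv recip_pos[OF p], of "ennreal r"] r by (simp add: lk_weight_def)
  then have "\<not> ennpowr (\<integral>\<^sup>+t. ennpowr (lk_weight p (ennreal r) b t * indicator {1<..} t) r \<partial>?L) (1 / r) < top"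
    using r by (simp add: Lq_norm_ennreal)
  then have "top = (\<integral>\<^sup>+t. ennpowr (lk_weight p (ennreal r) b t * indicator {1<..} t) r \<partial>?L)"
    unfolding ennpowr_less_top_iff by (simp add: not_less top_unique)
  also have "\<dots> \<le> (\<integral>\<^sup>+t. ?W t \<partial>?L)"
    using r by (intro nn_integral_mono) (auto simp: ennpowr_mult_indicator indicator_def)
  also have "\<dots> = (SUP n. H n)"
    unfolding H_def
  proof (rule nn_integral_exhaust)
    show "{0<..} \<subseteq> (\<Union>n. {..<real (Suc n)})"
    proof
      fix t :: real
      obtain n where "t < real n" using reals_Archimedean2 by blast
      then have "t < real (Suc n)" by simp
      then show "t \<in> (\<Union>n. {..<real (Suc n)})" by blast
    qed
  qed (auto simp: incseq_def)
  finally have sup: "(SUP n. H n) = top" by (simp add: top_unique)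
  obtain E0 where E0: "E0 \<in> sets M" "ennreal 0 < emeasure M E0" "emeasure M E0 < top"
    using ex_set_large_measure[OF sf inf] by blast
  have "Lq_norm (ennreal r) (\<lambda>t. lk_weight p (ennreal r) b t * indicator {0<..<real (Suc n)} t) < top"
    by (rule lk_norm_indicator_finiteD(1)[OF sv _ E0(1) _ E0(3) fin[OF E0(1,3)]]) (use r E0 in auto)
  then have "(\<integral>\<^sup>+t. ennpowr (lk_weight p (ennreal r) b t * indicator {0<..<real (Suc n)} t) r \<partial>?L) < top"
    using r by (simp add: Lq_norm_ennreal ennpowr_less_top_iff)
  also have "(\<integral>\<^sup>+t. ennpowr (lk_weight p (ennreal r) b t * indicator {0<..<real (Suc n)} t) r \<partial>?L) = H n"
    unfolding H_def using r by (intro nn_integral_cong) (auto simp: ennpowr_mult_indicator indicator_def)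
  finally have "1 + 2 * H n < (SUP n. H n)" unfolding sup by (simp add: ennreal_mult_less_top)
  \<comment> \<open>The bound \<open>H n\<close> for the early mass is independent of E, so k can be
    fixed before E is chosen.\<close>
  then obtain k where k: "1 + 2 * H n < H k" by (auto simp: less_SUP_iff)
  obtain E where E: "E \<in> sets M" "ennreal (real (Suc k)) < emeasure M E" "emeasure M E < top"
    using ex_set_large_measure[OF sf inf] by blast
  then obtain \<rho> where \<rho>: "emeasure M E = ennreal \<rho>" "0 \<le> \<rho>" "real (Suc k) < \<rho>"
    by (cases "emeasure M E") (auto simp: ennreal_less_iff simp del: of_nat_Suc)
  note avg = rearr_average_indicator_real[OF E(1) \<rho>(1,2)]
  have "(\<integral>\<^sup>+t\<in>{..<real (Suc n)}. lk_density M p r b (indicator E) t \<partial>?L) \<le> H n"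
    unfolding H_def lk_density_def
  proof (intro nn_integral_mono mult_right_mono ennpowr_mono)
    fix t :: real assume "t \<in> space ?L"
    then have "rearr_average M (indicator E) t \<le> 1" by (simp add: avg)
    then show "lk_weight p (ennreal r) b t * rearr_average M (indicator E) t \<le> lk_weight p (ennreal r) b t"
      using mult_left_mono by fastforce
  qed (use r in auto)
  then have "1 + 2 * (\<integral>\<^sup>+t\<in>{..<real (Suc n)}. lk_density M p r b (indicator E) t \<partial>?L) \<le> 1 + 2 * H n"
    by (intro add_left_mono mult_left_mono) auto
  also have "\<dots> \<le> H k" using k by simp
  also have "\<dots> \<le> (\<integral>\<^sup>+t. lk_density M p r b (indicator E) t \<partial>?L)"
    unfolding H_def lk_density_def
  proof (intro nn_integral_mono)
    fix t :: real assume t: "t \<in> space ?L"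
    show "?W t * indicator {..<real (Suc k)} t \<le> ennpowr (lk_weight p (ennreal r) b t * rearr_average M (indicator E) t) r"
    proof (cases "t < real (Suc k)")
      case True
      then have "min 1 (\<rho> / t) = 1" using t \<rho> by (simp add: min_def)
      then have "rearr_average M (indicator E) t = 1" using t by (simp add: avg)
      then show ?thesis using True by simp
    qed simp
  qed
  finally show ?thesis using E by blast
qed

text \<open>The roles of the ends are exchanged. For a set of measure rho the density is at most
  rho^r times the r-th power of the weight divided by t, with equality for t > rho. That power has
  infinite integral near zero and finite integral away from zero.\<close>

lemma small_sets_escape:
  assumes sf: "sigma_finite_measure M" and inf: "emeasure M (space M) = \<infinity>" and na: "nonatomic M"
    and sv: "slowly_varying b" and r: "0 < r"
    and fin: "\<And>E. E \<in> sets M \<Longrightarrow> emeasure M E < top \<Longrightarrow> on_nonneg (lk_norm M top (ennreal r) b) (indicator E) < top"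
  shows "\<exists>E\<in>sets M. emeasure M E < top \<and> (\<exists>c>0. c < top \<and>
    c + 2 * (\<integral>\<^sup>+t\<in>{1 / real (Suc n)<..}. lk_density M top r b (indicator E) t \<partial>lebesgue_on {0<..})
      \<le> (\<integral>\<^sup>+t. lk_density M top r b (indicator E) t \<partial>lebesgue_on {0<..}))"
proof -
  note [measurable] = lk_weight_measurable[OF sv]
  let ?L = "lebesgue_on {0::real<..}"
  let ?w = "\<lambda>t. lk_weight top (ennreal r) b t * ennreal (1 / t)"
  let ?W = "\<lambda>t. ennpowr (?w t) r"
  define G where "G = (\<lambda>n. \<integral>\<^sup>+t\<in>{1 / real (Suc n)<..}. ?W t \<partial>?L)"
  have [measurable]: "?W \<in> borel_measurable ?L" using r by measurable
  \<comment> \<open>Slow variation with exponent 1 gives b(t) >= t/K near zero, which is the case a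
    = -1 of the divergence criterion.\<close>
  obtain K where K: "0 < K" "\<And>t. 0 < t \<Longrightarrow> t \<le> 1 \<Longrightarrow> t powr 1 \<le> K * b t"
    using slowly_varying_bounds[OF sv, of 1] by auto
  have "top = (\<integral>\<^sup>+t. ennpowr (ennreal (t powr (-1 - recip (ennreal r)) * b t) * indicator {0<..<1} t) r \<partial>?L)"
    using r K sv by (intro Lq_norm_powr_infinite[where K = K, symmetric] nn_integral_inverse_near_0) (auto simp: slowly_varying_def)
  also have "\<dots> \<le> (\<integral>\<^sup>+t. ?W t \<partial>?L)"
  proof (rule nn_integral_mono)
    fix t :: real assume "t \<in> space ?L"
    then show "ennpowr (ennreal (t powr (-1 - recip (ennreal r)) * b t) * indicator {0<..<1} t) r \<le> ?W t"
      using r by (simp add: lk_weight_mult_inverse ennpowr_mult_indicator indicator_def)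
  qed
  also have "\<dots> = (SUP n. G n)"
    unfolding G_def
  proof (rule nn_integral_exhaust)
    show "{0::real<..} \<subseteq> (\<Union>n. {1 / real (Suc n)<..})"
    proof
      fix t :: real assume "t \<in> {0<..}"
      then obtain n where "1 / real (Suc n) < t" using reals_Archimedean[of t] by (auto simp: inverse_eq_divide)
      then show "t \<in> (\<Union>n. {1 / real (Suc n)<..})" by blast
    qed
    show "incseq (\<lambda>n. {1 / real (Suc n)<..})"
    proof (rule incseq_SucI)
      fix n
      have "1 / real (Suc (Suc n)) \<le> 1 / real (Suc n)" by (intro divide_left_mono) auto
      then show "{1 / real (Suc n)<..} \<subseteq> {1 / real (Suc (Suc n))<..}" by auto
    qed
  qed auto
  finally have sup: "(SUP n. G n) = top" by (simp add: top_unique)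
  obtain E0 where E0: "E0 \<in> sets M" "ennreal 0 < emeasure M E0" "emeasure M E0 < top"
    using ex_set_large_measure[OF sf inf] by blast
  have "Lq_norm (ennreal r) (\<lambda>t. ?w t * indicator {1 / real (Suc n)<..} t) < top"
    by (rule lk_norm_indicator_finiteD(2)[OF sv _ E0(1) _ E0(3) fin[OF E0(1,3)]]) (use r E0 in auto)
  then have "G n < top"
    using r by (simp add: Lq_norm_ennreal ennpowr_less_top_iff G_def ennpowr_mult_indicator)
  then have "1 + 2 * G n < (SUP n. G n)" unfolding sup by (simp add: ennreal_mult_less_top)
  then obtain k where k: "1 + 2 * G n < G k" by (auto simp: less_SUP_iff)
  obtain E where E: "E \<in> sets M" "0 < emeasure M E" "emeasure M E \<le> ennreal (1 / real (Suc k))"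
    using ex_set_small_measure[OF na E0(1) _ E0(3), of "1 / real (Suc k)"] E0(2) by auto
  then obtain \<rho> where \<rho>: "emeasure M E = ennreal \<rho>" "0 < \<rho>" "\<rho> \<le> 1 / real (Suc k)"
    by (cases "emeasure M E") (auto simp: ennreal_le_iff top_unique)
  note avg = rearr_average_indicator_real[OF E(1) \<rho>(1) less_imp_le[OF \<rho>(2)]]
  \<comment> \<open>Both masses carry this factor, so the additive surplus is rho^r instead of 1; it
    depends on E, and only its positivity matters later.\<close>
  let ?c = "ennreal (\<rho> powr r)"
  have scale: "ennpowr (lk_weight top (ennreal r) b t * ennreal (\<rho> / t)) r = ?c * ?W t" if "0 < t" for t
  proof -
    have "ennreal (\<rho> / t) = ennreal \<rho> * ennreal (1 / t)" using \<rho> that by (simp add: ennreal_mult[symmetric])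
    then have "lk_weight top (ennreal r) b t * ennreal (\<rho> / t) = ennreal \<rho> * ?w t" by (simp add: mult_ac)
    then show ?thesis using r \<rho> by (simp add: ennpowr_mult ennpowr_ennreal)
  qed
  have "(\<integral>\<^sup>+t\<in>{1 / real (Suc n)<..}. lk_density M top r b (indicator E) t \<partial>?L)
      \<le> (\<integral>\<^sup>+t. ?c * (?W t * indicator {1 / real (Suc n)<..} t) \<partial>?L)"
  proof (intro nn_integral_mono)
    fix t :: real assume t: "t \<in> space ?L"
    have "rearr_average M (indicator E) t \<le> ennreal (\<rho> / t)"
      using t by (simp add: avg ennreal_leI)
    then have "lk_density M top r b (indicator E) t \<le> ?c * ?W t"
      using t r unfolding lk_density_def
      by (subst scale[symmetric]) (auto intro!: ennpowr_mono mult_left_mono)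
    then show "lk_density M top r b (indicator E) t * indicator {1 / real (Suc n)<..} t
        \<le> ?c * (?W t * indicator {1 / real (Suc n)<..} t)"
      by (auto simp: indicator_def)
  qed
  also have "\<dots> = ?c * G n" unfolding G_def by (intro nn_integral_cmult) measurable
  finally have "?c + 2 * (\<integral>\<^sup>+t\<in>{1 / real (Suc n)<..}. lk_density M top r b (indicator E) t \<partial>?L)
      \<le> ?c + 2 * (?c * G n)"
    by (intro add_left_mono mult_left_mono) auto
  also have "\<dots> = ?c * (1 + 2 * G n)" by (simp add: algebra_simps)
  also have "\<dots> \<le> ?c * G k" using k by (intro mult_left_mono) auto
  also have "\<dots> = (\<integral>\<^sup>+t. ?c * (?W t * indicator {1 / real (Suc k)<..} t) \<partial>?L)"
    unfolding G_def by (intro nn_integral_cmult[symmetric]) measurable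
  also have "\<dots> \<le> (\<integral>\<^sup>+t. lk_density M top r b (indicator E) t \<partial>?L)"
  proof (intro nn_integral_mono)
    fix t :: real assume t: "t \<in> space ?L"
    show "?c * (?W t * indicator {1 / real (Suc k)<..} t) \<le> lk_density M top r b (indicator E) t"
    proof (cases "1 / real (Suc k) < t")
      case True
      then have "\<rho> < t" using \<rho> by linarith
      then have "min 1 (\<rho> / t) = \<rho> / t" using \<rho> by simp
      then have "rearr_average M (indicator E) t = ennreal (\<rho> / t)" using t by (simp add: avg)
      then show ?thesis using True t by (simp add: lk_density_def scale)
    qed simp
  qed
  finally show ?thesis using E \<rho> by (intro bexI[of _ E] conjI exI[of _ ?c]) (auto simp: less_top[symmetric])
qed

section \<open>Superposition of escaping functions\<close>

lemma ennreal_ge_half: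
  fixes x y :: ennreal
  assumes "x + y = 1" "2 * x \<le> 1"
  shows "1 \<le> 2 * y"
proof (rule ccontr)
  assume "\<not> 1 \<le> 2 * y"
  have "x < top" "y < top" using assms(1) by (auto simp: less_top[symmetric])
  then obtain r s where rs: "x = ennreal r" "0 \<le> r" "y = ennreal s" "0 \<le> s"
    by (cases x; cases y) auto
  have "ennreal (r + s) = ennreal 1" using assms(1) rs by simp
  then have "r + s = 1" using rs by (subst (asm) ennreal_inj) auto
  moreover have "ennreal (2 * r) \<le> ennreal 1" using assms(2) rs by (simp add: ennreal_mult)
  then have "2 * r \<le> 1" by (subst (asm) ennreal_le_iff) auto
  moreover have "ennreal (2 * s) < ennreal 1" using \<open>\<not> 1 \<le> 2 * y\<close> rs by (simp add: ennreal_mult not_le)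
  then have "2 * s < 1" using rs by (subst (asm) ennreal_less_iff) auto
  ultimately show False by linarith
qed

text \<open>Induction on the number of summands: the mass of the sum u built so far is already large
  enough on some member of the exhaustion, and the next summand has at least half of its unit mass
  outside that member. Here \<open>P\<close> stands for the supposed equivalent norm, of which only
  subadditivity enters.\<close>

lemma lk_density_superposition:
  assumes sv: "slowly_varying b" and r: "0 < r"
    and A: "\<And>n::nat. A n \<in> sets borel" "incseq A" "{0<..} \<subseteq> (\<Union>n. A n)"
    and sub: "\<And>u v. u \<in> borel_measurable M \<Longrightarrow> v \<in> borel_measurable M \<Longrightarrow> P (\<lambda>x. u x + v x) \<le> P u + P v"
    and ex: "\<And>n. \<exists>u\<in>borel_measurable M. (\<integral>\<^sup>+t. lk_density M p r b u t \<partial>lebesgue_on {0<..}) = 1 \<and>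
        2 * (\<integral>\<^sup>+t\<in>A n. lk_density M p r b u t \<partial>lebesgue_on {0<..}) \<le> 1 \<and> P u \<le> D"
  shows "\<exists>u\<in>borel_measurable M. of_nat (Suc k) < 2 * (\<integral>\<^sup>+t. lk_density M p r b u t \<partial>lebesgue_on {0<..}) \<and>
    P u \<le> of_nat (Suc k) * (D :: ennreal)"
proof (induction k)
  case 0
  obtain u where "u \<in> borel_measurable M" "(\<integral>\<^sup>+t. lk_density M p r b u t \<partial>lebesgue_on {0<..}) = 1" "P u \<le> D"
    using ex[of 0] by blast
  moreover have "(1::ennreal) < 2" by simp
  ultimately show ?case by (intro bexI[of _ u]) auto
next
  case (Suc k)
  let ?I = "\<lambda>u. \<integral>\<^sup>+t. lk_density M p r b u t \<partial>lebesgue_on {0<..}"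
  let ?J = "\<lambda>u S. \<integral>\<^sup>+t\<in>S. lk_density M p r b u t \<partial>lebesgue_on {0<..}"
  note [measurable] = A(1) lk_density_measurable[OF sv r]
  obtain u where u[measurable]: "u \<in> borel_measurable M" and u': "of_nat (Suc k) < 2 * ?I u" "P u \<le> of_nat (Suc k) * D"
    using Suc by blast
  \<comment> \<open>The induction carries a strict inequality precisely so that some
    \<open>A n\<close> already satisfies it.\<close>
  have "?I u = (SUP n. ?J u (A n))" by (intro nn_integral_exhaust A) measurable
  then have "of_nat (Suc k) < (SUP n. 2 * ?J u (A n))" using u'(1) by (simp add: SUP_mult_left_ennreal)
  then obtain n where n: "of_nat (Suc k) < 2 * ?J u (A n)" unfolding less_SUP_iff by blast
  obtain v where v[measurable]: "v \<in> borel_measurable M" and v': "?I v = 1" "2 * ?J v (A n) \<le> 1" "P v \<le> D"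
    using ex[of n] by blast
  have split: "?I w = ?J w (A n) + ?J w (- A n)" if [measurable]: "w \<in> borel_measurable M" for w
  proof -
    have "?I w = (\<integral>\<^sup>+t. lk_density M p r b w t * indicator (A n) t + lk_density M p r b w t * indicator (- A n) t \<partial>lebesgue_on {0<..})"
      by (intro nn_integral_cong) (auto simp: indicator_def)
    also have "\<dots> = ?J w (A n) + ?J w (- A n)" by (intro nn_integral_add) measurable
    finally show ?thesis .
  qed
  define w where "w = (\<lambda>x. u x + v x)"
  have w[measurable]: "w \<in> borel_measurable M" unfolding w_def by measurable
  have "1 \<le> 2 * ?J v (- A n)" using v'(1,2) unfolding split[OF v] by (rule ennreal_ge_half)
  have "of_nat (Suc (Suc k)) = 1 + of_nat (Suc k)" by simp
  also have "\<dots> < 1 + 2 * ?J u (A n)" using n by (simp add: ennreal_add_left_cancel_less)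
  also have "\<dots> \<le> 2 * ?J v (- A n) + 2 * ?J u (A n)" by (intro add_right_mono) fact
  \<comment> \<open>The sum dominates v off \<open>A n\<close> and u on \<open>A n\<close>.\<close>
  also have "\<dots> \<le> 2 * ?J w (- A n) + 2 * ?J w (A n)"
    using r by (intro add_mono mult_left_mono nn_integral_mono mult_right_mono lk_density_mono) (auto simp: w_def)
  also have "\<dots> = 2 * ?I w" unfolding split[OF w] by (simp add: distrib_left add.commute)
  finally have "of_nat (Suc (Suc k)) < 2 * ?I w" .
  moreover have "P w \<le> of_nat (Suc (Suc k)) * D"
  proof -
    have "P w \<le> P u + P v" unfolding w_def by (intro sub) auto
    also have "\<dots> \<le> of_nat (Suc k) * D + D" by (intro add_mono u' v')
    finally show ?thesis by (simp add: algebra_simps)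
  qed
  ultimately show ?case using w by blast
qed

lemma lk_density_normalize:
  assumes sv: "slowly_varying b" and r: "0 < r" and u[measurable]: "u \<in> borel_measurable M"
    and S: "S \<in> sets borel"
    and pos: "(\<integral>\<^sup>+t. lk_density M p r b u t \<partial>lebesgue_on {0<..}) \<noteq> 0"
    and fin: "(\<integral>\<^sup>+t. lk_density M p r b u t \<partial>lebesgue_on {0<..}) < top"
    and le: "2 * (\<integral>\<^sup>+t\<in>S. lk_density M p r b u t \<partial>lebesgue_on {0<..})
      \<le> (\<integral>\<^sup>+t. lk_density M p r b u t \<partial>lebesgue_on {0<..})"
  shows "\<exists>v\<in>borel_measurable M. (\<integral>\<^sup>+t. lk_density M p r b v t \<partial>lebesgue_on {0<..}) = 1 \<and>
    2 * (\<integral>\<^sup>+t\<in>S. lk_density M p r b v t \<partial>lebesgue_on {0<..}) \<le> 1"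
proof -
  note [measurable] = S lk_density_measurable[OF sv r]
  let ?I = "\<lambda>u. \<integral>\<^sup>+t. lk_density M p r b u t \<partial>lebesgue_on {0<..}"
  obtain \<phi> where \<phi>: "?I u = ennreal \<phi>" "0 < \<phi>" using pos fin by (cases "?I u") (auto simp: less_le)
  \<comment> \<open>The density is homogeneous of degree r, so this factor divides the total mass by
    itself.\<close>
  define s where "s = (1 / \<phi>) powr (1 / r)"
  have s: "0 \<le> s" "s powr r = 1 / \<phi>" using r \<phi> by (auto simp: s_def powr_powr)
  define v where "v = (\<lambda>x. ennreal s * u x)"
  have dens: "lk_density M p r b v t = ennreal (1 / \<phi>) * lk_density M p r b u t" for t
    unfolding v_def using lk_density_cmult[OF u r s(1)] by (simp add: s(2))
  have "?I v = ennreal (1 / \<phi>) * ?I u" unfolding dens by (intro nn_integral_cmult) measurable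
  also have "\<dots> = 1" using \<phi> by (simp add: ennreal_mult[symmetric])
  finally have one: "?I v = 1" .
  have "2 * (\<integral>\<^sup>+t\<in>S. lk_density M p r b v t \<partial>lebesgue_on {0<..})
      = ennreal (1 / \<phi>) * (2 * (\<integral>\<^sup>+t\<in>S. lk_density M p r b u t \<partial>lebesgue_on {0<..}))"
  proof -
    have "(\<integral>\<^sup>+t\<in>S. lk_density M p r b v t \<partial>lebesgue_on {0<..})
        = ennreal (1 / \<phi>) * (\<integral>\<^sup>+t\<in>S. lk_density M p r b u t \<partial>lebesgue_on {0<..})"
      unfolding dens mult.assoc by (intro nn_integral_cmult) measurable
    then show ?thesis by (simp add: mult_ac)
  qed
  also have "\<dots> \<le> ennreal (1 / \<phi>) * ?I u" by (intro mult_left_mono le) simp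
  also have "\<dots> = 1" using \<phi> by (simp add: ennreal_mult[symmetric])
  finally show ?thesis using one by (intro bexI[of _ v]) (auto simp: v_def)
qed

text \<open>Since r < 1, the left side grows sublinearly in k. This is the numerical source of the
  contradiction.\<close>

lemma powr_dominates_linear:
  fixes r B :: real
  assumes "0 < r" "r < 1" "0 < B"
  shows "\<exists>k::nat. (B * real (Suc k)) powr r < real (Suc k) / 2"
proof -
  \<comment> \<open>The solution of X^(1-r) = 2 B^r, the point at which the two sides
    balance.\<close>
  define X where "X = (2 * B powr r) powr (1 / (1 - r))"
  obtain k where "X < real k" using reals_Archimedean2 by blast
  then have k: "X < real (Suc k)" by simp
  have "2 * B powr r = X powr (1 - r)" using assms by (simp add: X_def powr_powr)
  also have "\<dots> < real (Suc k) powr (1 - r)" using k assms by (intro powr_less_mono2) (auto simp: X_def)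
  finally have "2 * B powr r * real (Suc k) powr r < real (Suc k) powr (1 - r) * real (Suc k) powr r"
    by (intro mult_strict_right_mono) auto
  also have "\<dots> = real (Suc k)" by (subst powr_add[symmetric]) simp
  finally have "(B * real (Suc k)) powr r < real (Suc k) / 2"
    using assms by (simp add: powr_mult del: of_nat_Suc)
  then show ?thesis by blast
qed

lemma banach_function_norm_add:
  "banach_function_norm M N \<Longrightarrow> u \<in> borel_measurable M \<Longrightarrow> v \<in> borel_measurable M \<Longrightarrow>
    on_nonneg N (\<lambda>x. u x + v x) \<le> on_nonneg N u + on_nonneg N v"
  by (simp add: banach_function_norm_def)

lemma banach_function_norm_indicator:
  "banach_function_norm M N \<Longrightarrow> E \<in> sets M \<Longrightarrow> emeasure M E < top \<Longrightarrow> on_nonneg N (indicator E) < top"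
  by (simp add: banach_function_norm_def)

lemma equivalent_on_nonneg:
  fixes M :: "'a measure"
  assumes "equivalent_on (mfuns M) N N'"
  obtains c C :: real where "0 < c" "c \<le> C"
    "\<And>u. u \<in> borel_measurable M \<Longrightarrow> ennreal c * on_nonneg N u \<le> on_nonneg N' u"
    "\<And>u. u \<in> borel_measurable M \<Longrightarrow> on_nonneg N' u \<le> ennreal C * on_nonneg N u"
proof -
  obtain c C :: real where "0 < c" "c \<le> C"
    and *: "\<And>f. f \<in> mfuns M \<Longrightarrow> ennreal c * N f \<le> N' f \<and> N' f \<le> ennreal C * N f"
    using assms unfolding equivalent_on_def by blast
  show thesis
  proof (rule that[OF \<open>0 < c\<close> \<open>c \<le> C\<close>])
    fix u :: "'a \<Rightarrow> ennreal" assume [measurable]: "u \<in> borel_measurable M"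
    have "(\<lambda>x. ecomplex_of_ennreal (u x)) \<in> mfuns M" by measurable
    from *[OF this] show "ennreal c * on_nonneg N u \<le> on_nonneg N' u" "on_nonneg N' u \<le> ennreal C * on_nonneg N u"
      by (auto simp: on_nonneg_def)
  qed
qed

text \<open>A function of unit mass has N at most 1/c, so a sum of K of them has N at most K/c and
  functional at most C K / c. Its mass is then at most (C K / c)^r, yet superposition makes it
  exceed K/2.\<close>

lemma lk_norm_exponent_ge_1:
  assumes sf: "sigma_finite_measure M" and na: "nonatomic M" and inf: "emeasure M (space M) = \<infinity>"
    and p: "0 < p" and q: "0 < q" and sv: "slowly_varying b"
    and bfn: "banach_function_norm M N" and eq: "equivalent_on (mfuns M) N (lk_norm M p q b)"
    and fin: "\<And>E. E \<in> sets M \<Longrightarrow> emeasure M E < top \<Longrightarrow> on_nonneg (lk_norm M p q b) (indicator E) < top"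
  shows "1 \<le> q"
proof (rule ccontr)
  assume "\<not> 1 \<le> q"
  then obtain r where r: "q = ennreal r" "0 < r" "r < 1" using q by (cases q) (auto simp: not_le)
  let ?I = "\<lambda>u. \<integral>\<^sup>+t. lk_density M p r b u t \<partial>lebesgue_on {0<..}"
  let ?J = "\<lambda>u S. \<integral>\<^sup>+t\<in>S. lk_density M p r b u t \<partial>lebesgue_on {0<..}"
  obtain c C where cC: "0 < c" "c \<le> C"
    "\<And>u. u \<in> borel_measurable M \<Longrightarrow> ennreal c * on_nonneg N u \<le> on_nonneg (lk_norm M p q b) u"
    "\<And>u. u \<in> borel_measurable M \<Longrightarrow> on_nonneg (lk_norm M p q b) u \<le> ennreal C * on_nonneg N u"
    using equivalent_on_nonneg[OF eq] by blast
  have norm: "on_nonneg (lk_norm M p q b) u = ennpowr (?I u) (1 / r)" if "u \<in> borel_measurable M" for u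
    using on_nonneg_lk_norm_eq_density[OF that r(2)] r(1) by simp
  have I_fin: "?I (indicator E) < top" if "E \<in> sets M" "emeasure M E < top" for E
    using fin[OF that] that by (simp add: norm ennpowr_less_top_iff)
  \<comment> \<open>Mass escapes to zero for p = infinity and to infinity otherwise; the exhaustion
    grows towards that end.\<close>
  define A where "A n = (if p = top then {1 / real (Suc n)<..} else {..<real (Suc n)})" for n :: nat
  have A_sets: "A n \<in> sets borel" for n by (simp add: A_def)
  have A_inc: "incseq A"
  proof (rule incseq_SucI)
    fix n
    have "1 / real (Suc (Suc n)) \<le> 1 / real (Suc n)" by (intro divide_left_mono) auto
    then show "A n \<subseteq> A (Suc n)" by (auto simp: A_def)
  qed
  have A_cover: "{0<..} \<subseteq> (\<Union>n. A n)"
  proof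
    fix t :: real assume t: "t \<in> {0<..}"
    obtain n where "1 / real (Suc n) < t" using t reals_Archimedean[of t] by (auto simp: inverse_eq_divide)
    moreover obtain m where "t < real m" using reals_Archimedean2 by blast
    then have "t < real (Suc m)" by simp
    ultimately have "t \<in> A (if p = top then n else m)" by (auto simp: A_def)
    then show "t \<in> (\<Union>n. A n)" by blast
  qed
  have escape: "\<exists>E\<in>sets M. emeasure M E < top \<and> (\<exists>c>0. c + 2 * ?J (indicator E) (A n) \<le> ?I (indicator E))" for n
  proof (cases "p = top")
    case True
    then show ?thesis
      using small_sets_escape[OF sf inf na sv r(2), of n] fin r(1) by (auto simp: A_def)
  next
    case False
    then have "p < top" by (simp add: less_top)
    then obtain E where "E \<in> sets M" "emeasure M E < top" "1 + 2 * ?J (indicator E) {..<real (Suc n)} \<le> ?I (indicator E)"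
      using large_sets_escape[OF sf inf sv p _ r(2), of n] fin r(1) by auto
    with False show ?thesis by (intro bexI[of _ E] conjI exI[of _ 1]) (auto simp: A_def)
  qed
  have ex: "\<exists>u\<in>borel_measurable M. ?I u = 1 \<and> 2 * ?J u (A n) \<le> 1 \<and> on_nonneg N u \<le> ennreal (1 / c)" for n
  proof -
    obtain E d where E: "E \<in> sets M" "emeasure M E < top" and d: "0 < d" "d + 2 * ?J (indicator E) (A n) \<le> ?I (indicator E)"
      using escape by blast
    \<comment> \<open>The surplus d makes the total mass non-zero, which permits normalisation;
      dropping it leaves the half-mass bound.\<close>
    have "d \<le> d + 2 * ?J (indicator E) (A n)" "2 * ?J (indicator E) (A n) \<le> d + 2 * ?J (indicator E) (A n)"
      by (auto intro: add_increasing2 add_increasing)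
    from this[THEN order_trans, OF d(2)] d(1)
    have "?I (indicator E) \<noteq> 0" "2 * ?J (indicator E) (A n) \<le> ?I (indicator E)" by auto
    then obtain u where u: "u \<in> borel_measurable M" "?I u = 1" "2 * ?J u (A n) \<le> 1"
      using lk_density_normalize[OF sv r(2) _ A_sets _ I_fin[OF E]] E by (auto intro: borel_measurable_indicator)
    have "on_nonneg (lk_norm M p q b) u = 1" using norm[OF u(1)] u(2) ennpowr_ennreal[of 1 "1 / r"] by simp
    then have "ennreal c * on_nonneg N u \<le> 1" using cC(3)[OF u(1)] by simp
    then have "ennreal (1 / c) * (ennreal c * on_nonneg N u) \<le> ennreal (1 / c) * 1" by (rule mult_left_mono) simp
    then have "on_nonneg N u \<le> ennreal (1 / c)"
      using cC(1) by (simp add: mult.assoc[symmetric] ennreal_mult[symmetric])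
    with u show ?thesis by blast
  qed
  obtain k where k: "(C / c * real (Suc k)) powr r < real (Suc k) / 2"
    using powr_dominates_linear[OF r(2,3), of "C / c"] cC(1,2) by auto
  obtain u where u: "u \<in> borel_measurable M" "of_nat (Suc k) < 2 * ?I u" "on_nonneg N u \<le> of_nat (Suc k) * ennreal (1 / c)"
    using lk_density_superposition[OF sv r(2) A_sets A_inc A_cover banach_function_norm_add[OF bfn] ex, of k] by blast
  have "ennpowr (?I u) (1 / r) \<le> ennreal C * on_nonneg N u" using cC(4)[OF u(1)] norm[OF u(1)] by simp
  also have "\<dots> \<le> ennreal C * (of_nat (Suc k) * ennreal (1 / c))" by (intro mult_left_mono u) simp
  also have "\<dots> = ennreal (C / c * real (Suc k))"
    using cC(1,2) by (simp add: ennreal_of_nat_eq_real_of_nat ennreal_mult[symmetric] mult_ac del: of_nat_Suc)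
  finally have "?I u \<le> ennpowr (ennreal (C / c * real (Suc k))) r"
    using r(2) ennpowr_le_iff[of "1 / r" "?I u" "ennreal (C / c * real (Suc k))"] by simp
  also have "\<dots> = ennreal ((C / c * real (Suc k)) powr r)" using cC(1,2) by (intro ennpowr_ennreal) simp
  also have "\<dots> \<le> ennreal (real (Suc k) / 2)" using k by (intro ennreal_leI) simp
  finally have "2 * ?I u \<le> 2 * ennreal (real (Suc k) / 2)" by (rule mult_left_mono) simp
  also have "\<dots> = ennreal (2 * (real (Suc k) / 2))" by (subst ennreal_mult) auto
  also have "\<dots> = of_nat (Suc k)" by (simp add: ennreal_of_nat_eq_real_of_nat del: of_nat_Suc)
  finally show False using u(2) by simp
qed

theorem theorem3p34:
  fixes M :: "'a measure" and p q :: ennreal and b :: "real \<Rightarrow> real"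
  assumes "sigma_finite_measure M"
    and "nonatomic M"
    and "emeasure M (space M) = \<infinity>"
    and "0 < p"
    and "0 < q"
    and "slowly_varying b"
  shows "((\<exists>N. banach_function_norm M N \<and>
              {f \<in> mfuns M. N f < \<infinity>} = lk_space M p q b \<and>
              equivalent_on (mfuns M) N (lk_norm M p q b))
            \<longleftrightarrow> lk_admissible p q b) \<and>
         (lk_admissible p q b \<longrightarrow> banach_function_norm M (lk_norm M p q b))"
proof (intro conjI iffI impI)
  assume "lk_admissible p q b"
  then show bfn: "banach_function_norm M (lk_norm M p q b)"
    by (rule lk_norm_banach_function_norm[OF assms(1,6)])
  have "equivalent_on (mfuns M) (lk_norm M p q b) (lk_norm M p q b)"
    unfolding equivalent_on_def by (intro exI[of _ 1]) simp
  with bfn show "\<exists>N. banach_function_norm M N \<and> {f \<in> mfuns M. N f < \<infinity>} = lk_space M p q b \<and>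
      equivalent_on (mfuns M) N (lk_norm M p q b)"
    by (intro exI[of _ "lk_norm M p q b"]) (simp add: lk_space_def)
next
  assume "\<exists>N. banach_function_norm M N \<and> {f \<in> mfuns M. N f < \<infinity>} = lk_space M p q b \<and>
      equivalent_on (mfuns M) N (lk_norm M p q b)"
  then obtain N where bfn: "banach_function_norm M N" and eq: "equivalent_on (mfuns M) N (lk_norm M p q b)"
    by blast
  obtain c C :: real where "0 < c" "c \<le> C"
    "\<And>u. u \<in> borel_measurable M \<Longrightarrow> ennreal c * on_nonneg N u \<le> on_nonneg (lk_norm M p q b) u"
    and C: "\<And>u. u \<in> borel_measurable M \<Longrightarrow> on_nonneg (lk_norm M p q b) u \<le> ennreal C * on_nonneg N u"
    using equivalent_on_nonneg[OF eq] by blast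
  \<comment> \<open>Finiteness on indicators passes from N to the functional through the upper
    constant C.\<close>
  have fin: "on_nonneg (lk_norm M p q b) (indicator E) < top" if "E \<in> sets M" "emeasure M E < top" for E
    using C[of "indicator E"] banach_function_norm_indicator[OF bfn that] that
    by (auto intro: le_less_trans simp: ennreal_mult_less_top)
  obtain E where E: "E \<in> sets M" "ennreal 0 < emeasure M E" "emeasure M E < top"
    using ex_set_large_measure[OF assms(1,3)] by blast
  then show "lk_admissible p q b"
    using lk_norm_exponent_ge_1[OF assms(1-6) bfn eq fin] lk_exponent_conditions[OF assms(6,4,5) E(1) _ E(3) fin[OF E(1,3)]]
    by (simp add: lk_admissible_def)
qed

end
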